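(* Let $L=2$ and suppose that $d_1,\gamma\to\infty$ with $d_1\sim c_1\frac{\log\gamma}{I_1}$ for some constant $c_1\in[0,\infty]$. Set $$D_\gamma=\begin{cases}\dfrac{\log\gamma}{I_1},& c_1>1,\\[2mm] \log\gamma\left(\dfrac{c_1}{I_1}+\dfrac{1-c_1}{I_2}\right),& c_1\le1.\end{cases}$$ (i) If the threshold $b=b(\gamma)$ of the D-CuSum algorithm can be selected so that $\widehat\tau(b)\in\mathcal C_\gamma$ and $b\sim\log\gamma$ as $\gamma\to\infty$, then (for such $b$) $$J^{d_1}_{\mathrm L}(\widehat\tau(b))\sim\inf_{\tau\in\mathcal C_\gamma}J^{d_1}_{\mathrm L}(\tau)\sim J^{d_1}_{\mathrm P}(\widehat\tau(b))\sim\inf_{\tau\in\mathcal C_\gamma}J^{d_1}_{\mathrm P}(\tau)\sim D_\gamma .$$ (ii) Suppose that the threshold $b=b(\gamma)$ of the WD-CuSum algorithm is selected so that $\mathbb{E}_\infty[\widetilde\tau(b)]\ge\gamma$ and $b\sim\log\gamma$ as $\gamma\to\infty$. If the weight $\rho_1\in(0,1)$ is chosen so that $\rho_1\to0$ and $\frac{\log\rho_1}{b}\to0$ as $b\to\infty$, then $$J^{d_1}_{\mathrm L}(\widetilde\tau(b))\sim\inf_{\tau\in\mathcal C_\gamma}J^{d_1}_{\mathrm L}(\tau)\sim J^{d_1}_{\mathrm P}(\widetilde\tau(b))\sim\inf_{\tau\in\mathcal C_\gamma}J^{d_1}_{\mathrm P}(\tau)\sim D_\gamma .$$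
   Context: Model ($L=2$). $f_0,f_1,f_2$ are known probability densities with respect to a common measure, and $I_i=\int f_i\log\frac{f_i}{f_0}$, $i=1,2$, are assumed positive and finite. Independent random variables $X_1,X_2,\dots$ are observed sequentially, $\mathcal F_k=\sigma(X_1,\dots,X_k)$. For a change-point $v_1\ge1$ and transient duration $d_1$ (a nonnegative integer), under $\mathbb{P}^{d_1}_{v_1}$ (expectation $\mathbb{E}^{d_1}_{v_1}$) the $X_k$ are independent with $X_k\sim f_0$ for $k<v_1$, $X_k\sim f_1$ for $v_1\le k<v_1+d_1$, and $X_k\sim f_2$ for $k\ge v_1+d_1$. Under $\mathbb{P}_\infty$ (expectation $\mathbb{E}_\infty$) all $X_k$ are i.i.d. with density $f_0$. For $\gamma>1$, $\mathcal C_\gamma$ is the set of $\{\mathcal F_k\}$-stopping times $\tau$ with $\mathbb{E}_\infty[\tau]\ge\gamma$. Worst-case average detection delays: $J^{d_1}_{\mathrm P}(\tau)=\sup_{v_1\ge1}\mathbb{E}^{d_1}_{v_1}[\tau-v_1\mid\tau\ge v_1]$ (Pollak) and $J^{d_1}_{\mathrm L}(\tau)=\sup_{v_1\ge1}\operatorname{ess\,sup}\mathbb{E}^{d_1}_{v_1}[(\tau-v_1)^+\mid X_1,\dots,X_{v_1-1}]$ (Lorden). D-CuSum: with $b>0$, $\widehat\tau(b)=\inf\{k\ge1:\widehat W[k]>b\}$, where (empty products equal $1$) $$\widehat W[k]=\max_{1\le v_1\le k}\ \max_{v_1\le v_2\le k+1}\log\left(\prod_{j=v_1}^{v_2-1}\frac{f_1(X_j)}{f_0(X_j)}\prod_{j=v_2}^{k}\frac{f_2(X_j)}{f_0(X_j)}\right).$$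 WD-CuSum: with weight $\rho_1\in(0,1)$ and $b>0$, $\widetilde\tau(b)=\inf\{k\ge1:\widetilde W[k]\ge b\}$, where $$(\widetilde W[k])^+=\max_{1\le v_1\le v_2\le k+1}\log\left(\rho_1^{\mathbf 1\{k\ge v_2\}}\prod_{j=v_1}^{v_2-1}\frac{(1-\rho_1)f_1(X_j)}{f_0(X_j)}\prod_{j=v_2}^{k}\frac{f_2(X_j)}{f_0(X_j)}\right);$$ since $b>0$, $\widetilde W[k]$ may be replaced by its positive part $(\widetilde W[k])^+$. Conventions: $g\sim h$ means $g/h\to1$; $d_1\sim c_1\log\gamma/I_1$ means $d_1I_1/\log\gamma\to c_1$ (with $c_1=0$ meaning $d_1=o(\log\gamma)$ and $c_1=\infty$ meaning $\log\gamma=o(d_1)$). *)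

theory Defs
  imports "HOL-Probability.Probability"
begin

text \<open>
  Kullback-Leibler number of \<open>f\<close> relative to \<open>g\<close> (densities with respect to \<open>\<mu>\<close>).
  The formula is the intended one only if \<open>f\<close> vanishes almost everywhere on
  \<open>{g = 0}\<close> and the integrand is integrable; the model below assumes both, and together
  they say that the divergence is finite.
\<close>

definition kl_number :: "'s measure \<Rightarrow> ('s \<Rightarrow> real) \<Rightarrow> ('s \<Rightarrow> real) \<Rightarrow> real" where
  "kl_number \<mu> f g = (\<integral>x. f x * ln (f x / g x) \<partial>\<mu>)"

text \<open>
  \<open>Pinf\<close> is the law without change and \<open>P d v\<close> the law with change-point \<open>v\<close> and transient
  duration \<open>d\<close>. All live on one measurable space. Observations are indexed from 1, so
  \<open>X 0\<close> and \<open>P d 0\<close> are unconstrained and never used.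
\<close>

locale transient_change_model =
  fixes \<mu> :: "'s measure"
    and f0 f1 f2 :: "'s \<Rightarrow> real"
    and X :: "nat \<Rightarrow> 'w \<Rightarrow> 's"
    and Pinf :: "'w measure"
    and P :: "nat \<Rightarrow> nat \<Rightarrow> 'w measure"
  assumes density_measurable:
      "f0 \<in> borel_measurable \<mu>" "f1 \<in> borel_measurable \<mu>" "f2 \<in> borel_measurable \<mu>"
    and density_nonneg:
      "\<And>x. x \<in> space \<mu> \<Longrightarrow> 0 \<le> f0 x" "\<And>x. x \<in> space \<mu> \<Longrightarrow> 0 \<le> f1 x"
      "\<And>x. x \<in> space \<mu> \<Longrightarrow> 0 \<le> f2 x"
    and density_mass:
      "(\<integral>\<^sup>+x. ennreal (f0 x) \<partial>\<mu>) = 1" "(\<integral>\<^sup>+x. ennreal (f1 x) \<partial>\<mu>) = 1"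
      "(\<integral>\<^sup>+x. ennreal (f2 x) \<partial>\<mu>) = 1"
    and kl_finite:
      "AE x in \<mu>. f0 x = 0 \<longrightarrow> f1 x = 0" "integrable \<mu> (\<lambda>x. f1 x * ln (f1 x / f0 x))"
      "AE x in \<mu>. f0 x = 0 \<longrightarrow> f2 x = 0" "integrable \<mu> (\<lambda>x. f2 x * ln (f2 x / f0 x))"
    and kl_pos: "0 < kl_number \<mu> f1 f0" "0 < kl_number \<mu> f2 f0"
    and prob_space_Pinf: "prob_space Pinf"
    and indep_Pinf: "prob_space.indep_vars Pinf (\<lambda>_. \<mu>) X {1..}"
    and distr_Pinf: "\<And>k. 1 \<le> k \<Longrightarrow> distributed Pinf \<mu> (X k) (\<lambda>x. ennreal (f0 x))"
    and sets_P: "\<And>d v. 1 \<le> v \<Longrightarrow> sets (P d v) = sets Pinf"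
    and prob_space_P: "\<And>d v. 1 \<le> v \<Longrightarrow> prob_space (P d v)"
    and indep_P: "\<And>d v. 1 \<le> v \<Longrightarrow> prob_space.indep_vars (P d v) (\<lambda>_. \<mu>) X {1..}"
    and distr_P: "\<And>d v k. 1 \<le> v \<Longrightarrow> 1 \<le> k \<Longrightarrow>
      distributed (P d v) \<mu> (X k)
        (\<lambda>x. ennreal (if k < v then f0 x else if k < v + d then f1 x else f2 x))"

text \<open>
  The filtration generated by the observations on the sample space \<open>\<Omega>\<close>. It is indexed by
  \<^typ>\<open>enat\<close> so that the library's \<^const>\<open>stopping_time\<close> covers stopping times that may take
  the value \<open>\<infinity>\<close>. At 0 it is the trivial sigma-algebra.
\<close>

definition obs_filtration ::
  "'w set \<Rightarrow> 's measure \<Rightarrow> (nat \<Rightarrow> 'w \<Rightarrow> 's) \<Rightarrow> enat \<Rightarrow> 'w measure" where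
  "obs_filtration \<Omega> \<mu> X t =
    sigma \<Omega> {X j -` A \<inter> \<Omega> | j A. 1 \<le> j \<and> enat j \<le> t \<and> A \<in> sets \<mu>}"

definition C_class ::
  "'s measure \<Rightarrow> (nat \<Rightarrow> 'w \<Rightarrow> 's) \<Rightarrow> 'w measure \<Rightarrow> real \<Rightarrow> ('w \<Rightarrow> enat) set" where
  "C_class \<mu> X Pinf \<gamma> =
    {\<tau>. stopping_time (obs_filtration (space Pinf) \<mu> X) \<tau> \<and>
        ennreal \<gamma> \<le> (\<integral>\<^sup>+\<omega>. ennreal_of_enat (\<tau> \<omega>) \<partial>Pinf)}"

text \<open>
  Subtraction on \<^typ>\<open>enat\<close> is truncated, so \<open>\<tau> \<omega> - enat v\<close> is the positive part, and it is
  \<open>\<infinity>\<close> where \<open>\<tau> \<omega> = \<infinity>\<close>. In Pollak's criterion only those change-points are considered for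
  which the conditioning event \<open>\<tau> \<ge> v\<close> has positive probability.
\<close>

definition pollak_delay ::
  "(nat \<Rightarrow> nat \<Rightarrow> 'w measure) \<Rightarrow> nat \<Rightarrow> ('w \<Rightarrow> enat) \<Rightarrow> ennreal" where
  "pollak_delay P d \<tau> =
    (SUP v \<in> {v. 1 \<le> v \<and> 0 < emeasure (P d v) {\<omega> \<in> space (P d v). enat v \<le> \<tau> \<omega>}}.
      \<integral>\<^sup>+\<omega>. ennreal_of_enat (\<tau> \<omega> - enat v)
        \<partial>uniform_measure (P d v) {\<omega> \<in> space (P d v). enat v \<le> \<tau> \<omega>})"

definition lorden_delay ::
  "'s measure \<Rightarrow> (nat \<Rightarrow> 'w \<Rightarrow> 's) \<Rightarrow> (nat \<Rightarrow> nat \<Rightarrow> 'w measure) \<Rightarrow> nat \<Rightarrow>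
    ('w \<Rightarrow> enat) \<Rightarrow> ennreal" where
  "lorden_delay \<mu> X P d \<tau> =
    (SUP v \<in> {1..}. esssup (P d v)
      (nn_cond_exp (P d v) (obs_filtration (space (P d v)) \<mu> X (enat (v - 1)))
        (\<lambda>\<omega>. ennreal_of_enat (\<tau> \<omega> - enat v))))"

text \<open>
  Logarithm with value \<open>-\<infinity>\<close> at 0 (whereas \<open>ln 0 = 0\<close> for the library's real logarithm):
  likelihood ratios vanish where \<open>f1\<close> or \<open>f2\<close> does. Points with \<open>f0 = 0\<close> are not observed,
  almost surely under each of the laws, so the value of the quotients there is irrelevant.
\<close>

definition elog :: "real \<Rightarrow> ereal" where
  "elog x = (if 0 < x then ereal (ln x) else -\<infinity>)"

definition dcusum_stat ::
  "('s \<Rightarrow> real) \<Rightarrow> ('s \<Rightarrow> real) \<Rightarrow> ('s \<Rightarrow> real) \<Rightarrow> (nat \<Rightarrow> 'w \<Rightarrow> 's) \<Rightarrow> nat \<Rightarrow> 'w \<Rightarrow> ereal" where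
  "dcusum_stat f0 f1 f2 X k \<omega> =
    (MAX v1 \<in> {1..k}. MAX v2 \<in> {v1..k + 1}.
      elog ((\<Prod>j\<in>{v1..<v2}. f1 (X j \<omega>) / f0 (X j \<omega>)) *
            (\<Prod>j\<in>{v2..k}. f2 (X j \<omega>) / f0 (X j \<omega>))))"

definition dcusum ::
  "('s \<Rightarrow> real) \<Rightarrow> ('s \<Rightarrow> real) \<Rightarrow> ('s \<Rightarrow> real) \<Rightarrow> (nat \<Rightarrow> 'w \<Rightarrow> 's) \<Rightarrow> real \<Rightarrow> 'w \<Rightarrow> enat" where
  "dcusum f0 f1 f2 X b \<omega> =
    Inf {enat k | k. 1 \<le> k \<and> ereal b < dcusum_stat f0 f1 f2 X k \<omega>}"

text \<open>
  This is the positive part of the WD-CuSum statistic (the choice \<open>v1 = v2 = k + 1\<close>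
  contributes \<open>log 1 = 0\<close>); for a positive threshold it crosses when the statistic does.
\<close>

definition wdcusum_stat ::
  "('s \<Rightarrow> real) \<Rightarrow> ('s \<Rightarrow> real) \<Rightarrow> ('s \<Rightarrow> real) \<Rightarrow> (nat \<Rightarrow> 'w \<Rightarrow> 's) \<Rightarrow> real \<Rightarrow> nat \<Rightarrow> 'w \<Rightarrow> ereal" where
  "wdcusum_stat f0 f1 f2 X \<rho> k \<omega> =
    (MAX (v1, v2) \<in> {(v1, v2). 1 \<le> v1 \<and> v1 \<le> v2 \<and> v2 \<le> k + 1}.
      elog (\<rho> ^ (if v2 \<le> k then 1 else 0) *
            (\<Prod>j\<in>{v1..<v2}. (1 - \<rho>) * f1 (X j \<omega>) / f0 (X j \<omega>)) *
            (\<Prod>j\<in>{v2..k}. f2 (X j \<omega>) / f0 (X j \<omega>))))"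

definition wdcusum ::
  "('s \<Rightarrow> real) \<Rightarrow> ('s \<Rightarrow> real) \<Rightarrow> ('s \<Rightarrow> real) \<Rightarrow> (nat \<Rightarrow> 'w \<Rightarrow> 's) \<Rightarrow> real \<Rightarrow> real \<Rightarrow> 'w \<Rightarrow> enat" where
  "wdcusum f0 f1 f2 X \<rho> b \<omega> =
    Inf {enat k | k. 1 \<le> k \<and> ereal b \<le> wdcusum_stat f0 f1 f2 X \<rho> k \<omega>}"

definition opt_delay :: "real \<Rightarrow> real \<Rightarrow> ereal \<Rightarrow> real \<Rightarrow> real" where
  "opt_delay I1 I2 c1 \<gamma> =
    (if c1 > 1 then ln \<gamma> / I1
     else ln \<gamma> * (real_of_ereal c1 / I1 + (1 - real_of_ereal c1) / I2))"

text \<open>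
  Asymptotic equivalence as \<open>\<gamma> \<rightarrow> \<infinity>\<close> for extended nonnegative quantities. As
  \<open>\<infinity> / \<infinity> = 0 / 0 = 0\<close> in \<^typ>\<open>ennreal\<close>, it entails that both sides are eventually
  finite and nonzero.
\<close>

definition ratio_equiv :: "(real \<Rightarrow> ennreal) \<Rightarrow> (real \<Rightarrow> ennreal) \<Rightarrow> bool" where
  "ratio_equiv g h \<longleftrightarrow> ((\<lambda>\<gamma>. g \<gamma> / h \<gamma>) \<longlongrightarrow> 1) at_top"

end

theory Submission
  imports Defs "HOL-Real_Asymp.Real_Asymp"
begin

text \<open>
  Let \<open>K\<close> be the number of post-change observations, in units of \<open>ln \<gamma>\<close>, whose mean log-likelihood
  ratio equals \<open>ln \<gamma>\<close>. Only first moments are available, so everything rests on an \<open>L\<^sup>1\<close> law of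
  large numbers for sums over blocks of observations, uniform in the position of the block.

  Lower bound: if the mean time to false alarm is at least \<open>\<gamma>\<close>, then for some \<open>v\<close> the conditional
  probability of a false alarm in \<open>{v..<v+m}\<close> given \<open>\<tau> \<ge> v\<close> is at most \<open>2 m / \<gamma>\<close>. For \<open>m\<close> slightly
  below \<open>K ln \<gamma>\<close> the likelihood ratio over that window is at most \<open>\<gamma>\<close> to a power less than 1, up to a
  small probability, so even with a change at \<open>v\<close> an alarm within \<open>m\<close> steps is unlikely.

  Upper bound: both rules stop by the end of any block over which the likelihood ratio of the true
  model exceeds the threshold (for WD-CuSum, a threshold enlarged by \<open>o(ln \<gamma>)\<close>). A first block
  slightly longer than \<open>K ln \<gamma>\<close> achieves this with probability near 1; if it does not, independent
  further blocks of length of order \<open>ln \<gamma>\<close> follow, and they contribute a geometric series with a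
  small ratio.
\<close>

text \<open>Two estimates suffice. Since \<open>pollak_delay\<close> never exceeds
  \<open>lorden_delay\<close>, a lower bound on Pollak's delay over the whole class and an upper
  bound on Lorden's delay of the given rule enclose every quantity in the chain of equivalences. The
  obstacle is uniformity: the change-point \<open>v\<close> and the block start are arbitrary and
  the transient duration moves with \<gamma>, so no limit theorem for one fixed sequence applies.
  What helps is that each post-change log-likelihood ratio has one of only two laws; one truncation
  level then serves all positions and durations. Both regimes of the optimal delay come from the
  function \<open>I2 * y + (I1 - I2) * min y c\<close>. In units of \<open>ln \<gamma>\<close> it is
  the mean log-likelihood ratio after time \<open>y\<close> when the transient lasts
  \<open>c\<close>. Its slope is at least \<open>min I1 I2 > 0\<close>, so a small relative change
  of the block length moves the mean by a fixed multiple of \<open>ln \<gamma>\<close>, which leaves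
  room for the random error. Likelihood ratios may vanish while \<open>ln 0 = 0\<close>; threshold
  events are therefore stated with products and turned into sums of logarithms only where all
  factors are positive.\<close>

lemma elog_less_iff: "ereal b < elog x \<longleftrightarrow> exp b < x"
  using ln_less_cancel_iff[of "exp b" x] by (auto simp: elog_def intro: order.strict_trans[OF exp_gt_zero])

lemma elog_ge_iff: "ereal b \<le> elog x \<longleftrightarrow> exp b \<le> x"
  using ln_le_cancel_iff[of "exp b" x] by (auto simp: elog_def intro: order.strict_trans2[OF exp_gt_zero])

section \<open>Mean absolute deviation of sums of independent variables\<close>

text \<open>Centred summands are uncorrelated, so the second moment of the sum grows only linearly.
  The resulting square-root growth is traded for an arbitrarily small linear slope plus a constant,
  a form that holds for all sizes at once and adds up with linear truncation errors.\<close>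

lemma (in prob_space) expectation_abs_bounded_indep_sum:
  fixes Y :: "'i \<Rightarrow> 'a \<Rightarrow> real" and K \<eta> :: real
  assumes I: "finite I" and ind: "indep_vars (\<lambda>_. borel) Y I"
    and bound: "\<And>i \<omega>. i \<in> I \<Longrightarrow> \<omega> \<in> space M \<Longrightarrow> \<bar>Y i \<omega>\<bar> \<le> K"
    and pos: "0 < K" "0 < \<eta>"
  shows "integrable M (\<lambda>\<omega>. \<Sum>i\<in>I. Y i \<omega> - expectation (Y i))"
    and "expectation (\<lambda>\<omega>. \<bar>\<Sum>i\<in>I. Y i \<omega> - expectation (Y i)\<bar>) \<le> \<eta> * card I + K\<^sup>2 / \<eta>"
proof -
  have meas: "Y i \<in> borel_measurable M" if "i \<in> I" for i
    using ind that unfolding indep_vars_def by auto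
  have int: "integrable M (Y i)" if "i \<in> I" for i
    by (rule integrable_const_bound[where B=K]) (use bound that meas in auto)
  define U where "U i \<omega> = Y i \<omega> - expectation (Y i)" for i \<omega>
  define S where "S \<omega> = (\<Sum>i\<in>I. U i \<omega>)" for \<omega>
  have measU: "U i \<in> borel_measurable M" if "i \<in> I" for i
    using meas[OF that] unfolding U_def by measurable
  have expY: "\<bar>expectation (Y i)\<bar> \<le> K" if "i \<in> I" for i
  proof -
    have "\<bar>expectation (Y i)\<bar> \<le> expectation (\<lambda>\<omega>. \<bar>Y i \<omega>\<bar>)"
      by (rule integral_abs_bound)
    also have "\<dots> \<le> expectation (\<lambda>_. K)"
      using int that bound by (intro integral_mono) auto
    finally show ?thesis by (simp add: prob_space)
  qed
  have boundU: "\<bar>U i \<omega>\<bar> \<le> 2 * K" if "i \<in> I" "\<omega> \<in> space M" for i \<omega>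
    using bound[OF that] expY[OF that(1)] unfolding U_def by linarith
  have intU: "integrable M (U i)" if "i \<in> I" for i
    unfolding U_def using int that by simp
  have intUU: "integrable M (\<lambda>\<omega>. U i \<omega> * U j \<omega>)" if "i \<in> I" "j \<in> I" for i j
  proof (rule integrable_const_bound[where B="(2*K)*(2*K)"])
    show "AE \<omega> in M. norm (U i \<omega> * U j \<omega>) \<le> (2*K)*(2*K)"
      unfolding real_norm_def abs_mult
      by (intro AE_I2 mult_mono boundU that) (use pos in auto)
  qed (use that measU in auto)
  have indU: "indep_vars (\<lambda>_. borel) U I"
    unfolding U_def by (rule indep_vars_compose2[OF ind]) auto
  have cov: "expectation (\<lambda>\<omega>. U i \<omega> * U j \<omega>) = 0" if "i \<in> I" "j \<in> I" "i \<noteq> j" for i j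
  proof -
    have "expectation (\<lambda>\<omega>. \<Prod>k\<in>{i,j}. U k \<omega>) = (\<Prod>k\<in>{i,j}. expectation (U k))"
      using that intU by (intro indep_vars_lebesgue_integral indep_vars_subset[OF indU]) auto
    moreover have "expectation (U i) = 0"
      unfolding U_def using int[OF that(1)] by (simp add: prob_space)
    ultimately show ?thesis using that by simp
  qed
  have var: "expectation (\<lambda>\<omega>. U i \<omega> * U i \<omega>) \<le> (2*K)*(2*K)" if "i \<in> I" for i
  proof -
    have "expectation (\<lambda>\<omega>. U i \<omega> * U i \<omega>) \<le> expectation (\<lambda>_. (2*K)*(2*K))"
    proof (rule integral_mono)
      fix \<omega> assume "\<omega> \<in> space M"
      then have "\<bar>U i \<omega>\<bar> * \<bar>U i \<omega>\<bar> \<le> (2*K)*(2*K)"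
        using boundU that pos by (intro mult_mono) auto
      then show "U i \<omega> * U i \<omega> \<le> (2*K)*(2*K)" by simp
    qed (use that intUU in auto)
    then show ?thesis by (simp add: prob_space)
  qed
  have S2: "(S \<omega>)\<^sup>2 = (\<Sum>i\<in>I. \<Sum>j\<in>I. U i \<omega> * U j \<omega>)" for \<omega>
    unfolding S_def power2_eq_square by (rule sum_product)
  have intS2: "integrable M (\<lambda>\<omega>. (S \<omega>)\<^sup>2)"
    unfolding S2 using intUU by auto
  have "expectation (\<lambda>\<omega>. (S \<omega>)\<^sup>2) = (\<Sum>i\<in>I. \<Sum>j\<in>I. expectation (\<lambda>\<omega>. U i \<omega> * U j \<omega>))"
    unfolding S2 using intUU by simp
  also have "\<dots> = (\<Sum>i\<in>I. \<Sum>j\<in>I. if i = j then expectation (\<lambda>\<omega>. U i \<omega> * U i \<omega>) else 0)"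
    using cov by (intro sum.cong) auto
  also have "\<dots> = (\<Sum>i\<in>I. expectation (\<lambda>\<omega>. U i \<omega> * U i \<omega>))"
    using I by (simp add: sum.delta)
  also have "\<dots> \<le> (\<Sum>i\<in>I. (2*K)*(2*K))"
    by (intro sum_mono var)
  finally have ES2: "expectation (\<lambda>\<omega>. (S \<omega>)\<^sup>2) \<le> card I * (4 * K\<^sup>2)"
    by (simp add: power2_eq_square algebra_simps)
  have intS: "integrable M S"
    unfolding S_def using intU by simp
  \<comment> \<open>Chosen so that the second-moment term of the AM-GM bound becomes exactly
    \<open>\<eta> * card I\<close>; the leftover \<open>t / 2\<close> is the constant term.\<close>
  define t where "t = 2 * K\<^sup>2 / \<eta>"
  have t: "0 < t" using pos by (simp add: t_def)
  have amgm: "\<bar>x\<bar> \<le> x\<^sup>2 / (2 * t) + t / 2" for x :: real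
  proof -
    have "0 \<le> (\<bar>x\<bar> - t)\<^sup>2" by simp
    then show ?thesis using t by (simp add: power2_diff field_simps power2_eq_square)
  qed
  have "expectation (\<lambda>\<omega>. \<bar>S \<omega>\<bar>) \<le> expectation (\<lambda>\<omega>. (S \<omega>)\<^sup>2 / (2 * t) + t / 2)"
    using intS intS2 amgm by (intro integral_mono) auto
  also have "\<dots> = expectation (\<lambda>\<omega>. (S \<omega>)\<^sup>2) / (2 * t) + t / 2"
    using intS2 by (simp add: prob_space)
  also have "\<dots> \<le> card I * (4 * K\<^sup>2) / (2 * t) + t / 2"
    using ES2 t by (intro add_right_mono divide_right_mono) auto
  also have "\<dots> = \<eta> * card I + K\<^sup>2 / \<eta>"
    using pos by (simp add: t_def field_simps)
  finally show "expectation (\<lambda>\<omega>. \<bar>\<Sum>i\<in>I. Y i \<omega> - expectation (Y i)\<bar>) \<le> \<eta> * card I + K\<^sup>2 / \<eta>"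
    by (simp add: S_def U_def)
  show "integrable M (\<lambda>\<omega>. \<Sum>i\<in>I. Y i \<omega> - expectation (Y i))"
    using intS by (simp add: S_def[abs_def] U_def)
qed

text \<open>Truncation at \<open>K\<close>: the bounded part falls under the previous lemma with
  slope \<eta>, and each remainder costs \<eta> for itself and \<eta> for its mean, hence the factor
  3.\<close>

lemma (in prob_space) expectation_abs_indep_sum:
  fixes Y :: "'i \<Rightarrow> 'a \<Rightarrow> real" and K \<eta> :: real
  assumes I: "finite I" and ind: "indep_vars (\<lambda>_. borel) Y I"
    and int: "\<And>i. i \<in> I \<Longrightarrow> integrable M (Y i)"
    and tail: "\<And>i. i \<in> I \<Longrightarrow> expectation (\<lambda>\<omega>. if K < \<bar>Y i \<omega>\<bar> then \<bar>Y i \<omega>\<bar> else 0) \<le> \<eta>"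
    and pos: "0 < K" "0 < \<eta>"
  shows "expectation (\<lambda>\<omega>. \<bar>\<Sum>i\<in>I. Y i \<omega> - expectation (Y i)\<bar>) \<le> 3 * \<eta> * card I + K\<^sup>2 / \<eta>"
proof -
  \<comment> \<open>Large values are replaced by 0 instead of being clipped to \<open>K\<close>, so
    that the remainder is exactly the integrand of the tail assumption.\<close>
  define T where "T x = (if \<bar>x\<bar> \<le> K then x else 0)" for x :: real
  have T[measurable]: "T \<in> borel_measurable borel" unfolding T_def by measurable
  define U where "U i \<omega> = T (Y i \<omega>)" for i \<omega>
  define V where "V i \<omega> = Y i \<omega> - U i \<omega>" for i \<omega>
  have indU: "indep_vars (\<lambda>_. borel) U I"
    unfolding U_def by (rule indep_vars_compose2[OF ind]) auto
  have boundU: "\<bar>U i \<omega>\<bar> \<le> K" if "i \<in> I" "\<omega> \<in> space M" for i \<omega>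
    using pos by (auto simp: U_def T_def)
  have bU: "integrable M (\<lambda>\<omega>. \<Sum>i\<in>I. U i \<omega> - expectation (U i))"
      "expectation (\<lambda>\<omega>. \<bar>\<Sum>i\<in>I. U i \<omega> - expectation (U i)\<bar>) \<le> \<eta> * card I + K\<^sup>2 / \<eta>"
    using expectation_abs_bounded_indep_sum[OF I indU _ pos] boundU by auto
  have measY: "Y i \<in> borel_measurable M" if "i \<in> I" for i
    using int[OF that] by auto
  have intU: "integrable M (U i)" if "i \<in> I" for i
    by (rule integrable_const_bound[where B=K]) (use boundU[OF that] measY[OF that] in \<open>auto simp: U_def[abs_def]\<close>)
  have intV: "integrable M (V i)" if "i \<in> I" for i
    unfolding V_def using int intU that by simp
  have absV: "expectation (\<lambda>\<omega>. \<bar>V i \<omega>\<bar>) \<le> \<eta>" if "i \<in> I" for i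
  proof -
    have "(\<lambda>\<omega>. \<bar>V i \<omega>\<bar>) = (\<lambda>\<omega>. if K < \<bar>Y i \<omega>\<bar> then \<bar>Y i \<omega>\<bar> else 0)"
      by (auto simp: V_def U_def T_def)
    then show ?thesis using tail[OF that] by simp
  qed
  have EY: "expectation (Y i) = expectation (U i) + expectation (V i)" if "i \<in> I" for i
    unfolding V_def using int intU that by simp
  have "expectation (\<lambda>\<omega>. \<bar>\<Sum>i\<in>I. Y i \<omega> - expectation (Y i)\<bar>) \<le>
    expectation (\<lambda>\<omega>. \<bar>\<Sum>i\<in>I. U i \<omega> - expectation (U i)\<bar> + (\<Sum>i\<in>I. \<bar>V i \<omega>\<bar> + \<bar>expectation (V i)\<bar>))"
  proof (rule integral_mono)
    fix \<omega>
    have "(\<Sum>i\<in>I. Y i \<omega> - expectation (Y i)) =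
      (\<Sum>i\<in>I. U i \<omega> - expectation (U i)) + (\<Sum>i\<in>I. V i \<omega> - expectation (V i))"
      unfolding sum.distrib[symmetric] by (intro sum.cong) (auto simp: EY V_def)
    moreover have "\<bar>\<Sum>i\<in>I. V i \<omega> - expectation (V i)\<bar> \<le> (\<Sum>i\<in>I. \<bar>V i \<omega>\<bar> + \<bar>expectation (V i)\<bar>)"
      by (rule order.trans[OF sum_abs]) (intro sum_mono abs_triangle_ineq4)
    ultimately show "\<bar>\<Sum>i\<in>I. Y i \<omega> - expectation (Y i)\<bar> \<le>
      \<bar>\<Sum>i\<in>I. U i \<omega> - expectation (U i)\<bar> + (\<Sum>i\<in>I. \<bar>V i \<omega>\<bar> + \<bar>expectation (V i)\<bar>)"
      by linarith
  qed (use bU(1) int intV in auto)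
  also have "\<dots> = expectation (\<lambda>\<omega>. \<bar>\<Sum>i\<in>I. U i \<omega> - expectation (U i)\<bar>) +
     (\<Sum>i\<in>I. expectation (\<lambda>\<omega>. \<bar>V i \<omega>\<bar>) + \<bar>expectation (V i)\<bar>)"
    using bU(1) intV by (simp add: prob_space Bochner_Integration.integral_sum)
  also have "\<dots> \<le> (\<eta> * card I + K\<^sup>2 / \<eta>) + (\<Sum>i\<in>I. \<eta> + \<eta>)"
    by (intro add_mono sum_mono bU(2) absV order.trans[OF integral_abs_bound absV])
  also have "\<dots> = 3 * \<eta> * card I + K\<^sup>2 / \<eta>" by simp
  finally show ?thesis .
qed

text \<open>Dominated convergence. There are two functions because truncation concerns the size of
  the log-ratio \<open>h\<close>, whereas \<open>g\<close> also carries the density as a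
  factor.\<close>

lemma tail_integral_small:
  fixes g h :: "'b \<Rightarrow> real"
  assumes g: "integrable M g" and [measurable]: "h \<in> borel_measurable M" and \<eta>: "0 < \<eta>"
  shows "\<forall>\<^sub>F n in sequentially. (\<integral>x. (if real n < \<bar>h x\<bar> then \<bar>g x\<bar> else 0) \<partial>M) < \<eta>"
proof -
  have [measurable]: "g \<in> borel_measurable M" using g by auto
  have "(\<lambda>n. \<integral>x. (if real n < \<bar>h x\<bar> then \<bar>g x\<bar> else 0) \<partial>M) \<longlonglongrightarrow> (\<integral>x. 0 \<partial>M)"
  proof (rule integral_dominated_convergence[where w="\<lambda>x. \<bar>g x\<bar>"])
    show "AE x in M. (\<lambda>n. if real n < \<bar>h x\<bar> then \<bar>g x\<bar> else 0) \<longlonglongrightarrow> 0"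
    proof (rule AE_I2, rule tendsto_eventually)
      fix x
      obtain N :: nat where "\<bar>h x\<bar> \<le> real N" using real_arch_simple by blast
      then show "\<forall>\<^sub>F n in sequentially. (if real n < \<bar>h x\<bar> then \<bar>g x\<bar> else 0) = 0"
        unfolding eventually_sequentially by (intro exI[of _ N]) auto
    qed
  qed (use g in auto)
  then show ?thesis using \<eta> by (simp add: order_tendsto_iff)
qed

section \<open>Auxiliary facts on sums, conditional expectations and limits\<close>

text \<open>Raising the shift by one adds a telescoping sum, whose value is a difference of two
  numbers in [0,1].\<close>

lemma sum_shift_le:
  fixes q :: "nat \<Rightarrow> real"
  assumes "\<And>k. 0 \<le> q k" "\<And>k. q k \<le> 1"
  shows "(\<Sum>k<N. q k - q (k + m)) \<le> m"
proof (induction m)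
  case (Suc m)
  have "(\<Sum>k<N. q k - q (k + Suc m)) = (\<Sum>k<N. q k - q (k + m)) + (\<Sum>k<N. q (k + m) - q (Suc k + m))"
    unfolding sum.distrib[symmetric] by (intro sum.cong) auto
  also have "(\<Sum>k<N. q (k + m) - q (Suc k + m)) = q (0 + m) - q (N + m)"
    by (rule sum_lessThan_telescope')
  finally show ?case
    using Suc assms(1)[of "N + m"] assms(2)[of m] by simp
qed simp

text \<open>The assumption is tested on the set where the conditional expectation exceeds
  \<open>c\<close>: there the excess is nonnegative with integral 0. Finiteness of \<open>c\<close>
  and of the total mass is what makes the subtraction of integrals in \<open>ennreal\<close>
  legitimate.\<close>

lemma (in sigma_finite_subalgebra) nn_cond_exp_le_const:
  assumes M: "emeasure M (space M) \<noteq> \<infinity>"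
    and f[measurable]: "f \<in> borel_measurable M" and c: "c \<noteq> \<infinity>"
    and le: "\<And>A. A \<in> sets F \<Longrightarrow> (\<integral>\<^sup>+x. f x * indicator A x \<partial>M) \<le> c * emeasure M A"
  shows "AE x in M. nn_cond_exp M F f x \<le> c"
proof -
  let ?g = "nn_cond_exp M F f"
  define A where "A = {x \<in> space F. c < ?g x}"
  have AF: "A \<in> sets F" unfolding A_def by measurable
  then have [measurable]: "A \<in> sets M" using subalg unfolding subalgebra_def by auto
  have finA: "c * emeasure M A \<noteq> \<infinity>"
    using c M emeasure_space[of M A] by (auto simp: ennreal_mult_eq_top_iff top_unique)
  have "(\<integral>\<^sup>+x. ?g x * indicator A x - c * indicator A x \<partial>M) =
    (\<integral>\<^sup>+x. ?g x * indicator A x \<partial>M) - (\<integral>\<^sup>+x. c * indicator A x \<partial>M)"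
  proof (rule nn_integral_diff)
    show "(\<integral>\<^sup>+x. c * indicator A x \<partial>M) \<noteq> \<infinity>"
      using finA by (simp add: nn_integral_cmult)
    show "AE x in M. c * indicator A x \<le> ?g x * indicator A x"
      by (rule AE_I2) (auto simp: A_def indicator_def)
  qed measurable
  also have "(\<integral>\<^sup>+x. ?g x * indicator A x \<partial>M) = (\<integral>\<^sup>+x. f x * indicator A x \<partial>M)"
    using nn_cond_exp_intg[of "indicator A" f] AF by (simp add: mult.commute)
  also have "(\<integral>\<^sup>+x. f x * indicator A x \<partial>M) - (\<integral>\<^sup>+x. c * indicator A x \<partial>M) = 0"
    using le[OF AF] finA by (intro diff_eq_0_ennreal) (auto simp: nn_integral_cmult less_top)
  finally have "AE x in M. ?g x * indicator A x - c * indicator A x = 0"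
    by (subst (asm) nn_integral_0_iff_AE) auto
  then show ?thesis
    using AE_space
  proof eventually_elim
    case (elim x)
    show ?case
    proof (rule ccontr)
      assume "\<not> ?g x \<le> c"
      then have "x \<in> A" "0 < ?g x - c"
        using elim subalg diff_gr0_ennreal[of c "?g x"] by (auto simp: A_def subalgebra_def not_le)
      with elim show False by simp
    qed
  qed
qed

text \<open>The upper bound makes \<open>g\<close> eventually finite, so that quotients can be
  handled in the reals, where the limit rules for division apply.\<close>

lemma asymp_sandwich:
  fixes D :: "real \<Rightarrow> real" and g :: "real \<Rightarrow> ennreal"
  assumes D: "\<forall>\<^sub>F \<gamma> in at_top. 0 < D \<gamma>"
    and g: "\<And>\<epsilon>. 0 < \<epsilon> \<Longrightarrow> \<epsilon> < 1 \<Longrightarrow>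
      \<forall>\<^sub>F \<gamma> in at_top. ennreal ((1 - \<epsilon>) * D \<gamma>) \<le> g \<gamma> \<and> g \<gamma> \<le> ennreal ((1 + \<epsilon>) * D \<gamma>)"
  shows "\<forall>\<^sub>F \<gamma> in at_top. g \<gamma> = ennreal (enn2real (g \<gamma>))"
    and "((\<lambda>\<gamma>. enn2real (g \<gamma>) / D \<gamma>) \<longlongrightarrow> 1) at_top"
proof -
  show "\<forall>\<^sub>F \<gamma> in at_top. g \<gamma> = ennreal (enn2real (g \<gamma>))"
    using g[of "1/2", simplified]
  proof eventually_elim
    case (elim \<gamma>)
    then show ?case by (cases "g \<gamma>") (auto simp: top_unique)
  qed
  show "((\<lambda>\<gamma>. enn2real (g \<gamma>) / D \<gamma>) \<longlongrightarrow> 1) at_top"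
  proof (rule tendstoI)
    fix e :: real assume e: "0 < e"
    define \<epsilon> where "\<epsilon> = min (e / 2) (1 / 2)"
    have \<epsilon>: "0 < \<epsilon>" "\<epsilon> < 1" "\<epsilon> < e" using e by (auto simp: \<epsilon>_def)
    show "\<forall>\<^sub>F \<gamma> in at_top. dist (enn2real (g \<gamma>) / D \<gamma>) 1 < e"
      using D g[OF \<epsilon>(1,2)]
    proof eventually_elim
      case (elim \<gamma>)
      then obtain r where r: "g \<gamma> = ennreal r" "0 \<le> r"
        by (cases "g \<gamma>") (auto simp: top_unique)
      have "(1 - \<epsilon>) * D \<gamma> \<le> r" "r \<le> (1 + \<epsilon>) * D \<gamma>"
        using elim r \<epsilon> by (auto simp: ennreal_le_iff)
      then have "1 - \<epsilon> \<le> r / D \<gamma>" "r / D \<gamma> \<le> 1 + \<epsilon>"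
        using elim by (auto simp: field_simps)
      then show ?case using r \<epsilon> by (simp add: dist_real_def)
    qed
  qed
qed

lemma ratio_equiv_sandwich:
  fixes D :: "real \<Rightarrow> real" and g h :: "real \<Rightarrow> ennreal"
  assumes D: "\<forall>\<^sub>F \<gamma> in at_top. 0 < D \<gamma>"
    and g: "\<And>\<epsilon>. 0 < \<epsilon> \<Longrightarrow> \<epsilon> < 1 \<Longrightarrow>
      \<forall>\<^sub>F \<gamma> in at_top. ennreal ((1 - \<epsilon>) * D \<gamma>) \<le> g \<gamma> \<and> g \<gamma> \<le> ennreal ((1 + \<epsilon>) * D \<gamma>)"
    and h: "\<And>\<epsilon>. 0 < \<epsilon> \<Longrightarrow> \<epsilon> < 1 \<Longrightarrow>
      \<forall>\<^sub>F \<gamma> in at_top. ennreal ((1 - \<epsilon>) * D \<gamma>) \<le> h \<gamma> \<and> h \<gamma> \<le> ennreal ((1 + \<epsilon>) * D \<gamma>)"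
  shows "ratio_equiv g h"
proof -
  have G: "\<forall>\<^sub>F \<gamma> in at_top. g \<gamma> = ennreal (enn2real (g \<gamma>))" "((\<lambda>\<gamma>. enn2real (g \<gamma>) / D \<gamma>) \<longlongrightarrow> 1) at_top"
    using asymp_sandwich[of D g] D g by auto
  have H: "\<forall>\<^sub>F \<gamma> in at_top. h \<gamma> = ennreal (enn2real (h \<gamma>))" "((\<lambda>\<gamma>. enn2real (h \<gamma>) / D \<gamma>) \<longlongrightarrow> 1) at_top"
    using asymp_sandwich[of D h] D h by auto
  have "((\<lambda>\<gamma>. (enn2real (g \<gamma>) / D \<gamma>) / (enn2real (h \<gamma>) / D \<gamma>)) \<longlongrightarrow> 1 / 1) at_top"
    by (intro tendsto_divide G(2) H(2)) auto
  then have "((\<lambda>\<gamma>. ennreal ((enn2real (g \<gamma>) / D \<gamma>) / (enn2real (h \<gamma>) / D \<gamma>))) \<longlongrightarrow> ennreal (1 / 1)) at_top"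
    by (rule tendsto_ennrealI)
  moreover have "\<forall>\<^sub>F \<gamma> in at_top. ennreal ((enn2real (g \<gamma>) / D \<gamma>) / (enn2real (h \<gamma>) / D \<gamma>)) = g \<gamma> / h \<gamma>"
    using D G(1) H(1) order_tendstoD(1)[OF H(2), of 0, simplified]
  proof eventually_elim
    case (elim \<gamma>)
    have "0 < enn2real (h \<gamma>)" using elim by (simp add: zero_less_divide_iff)
    then have "ennreal (enn2real (g \<gamma>)) / ennreal (enn2real (h \<gamma>)) = ennreal (enn2real (g \<gamma>) / enn2real (h \<gamma>))"
      by (intro divide_ennreal) auto
    then show ?case using elim by simp
  qed
  ultimately show ?thesis
    unfolding ratio_equiv_def by (simp add: filterlim_cong[OF refl refl])
qed

lemma eventually_le_ln: "\<forall>\<^sub>F \<gamma>::real in at_top. R \<le> ln \<gamma>"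
  using ln_at_top by (simp add: filterlim_at_top)

text \<open>The function is \<open>I1\<close> times the part of \<open>y\<close> up to
  \<open>c\<close> plus \<open>I2\<close> times the part beyond, and both parts increase with
  \<open>y\<close>. Hence no increment has slope below the smaller coefficient.\<close>

lemma min_slope:
  fixes I1 I2 :: real
  assumes "y \<le> y'"
  shows "min I1 I2 * (y' - y) \<le> (I2 * y' + (I1 - I2) * min y' c) - (I2 * y + (I1 - I2) * min y c)"
proof -
  have 1: "min I1 I2 * (min y' c - min y c) \<le> I1 * (min y' c - min y c)"
    using assms by (intro mult_right_mono) auto
  have 2: "min I1 I2 * ((y' - min y' c) - (y - min y c)) \<le> I2 * ((y' - min y' c) - (y - min y c))"
    using assms by (intro mult_right_mono) auto
  from add_mono[OF 1 2] show ?thesis by (simp add: algebra_simps)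
qed

lemma min_scale:
  fixes x y c I1 I2 :: real
  assumes "0 < x"
  shows "x * (I2 * (y / x) + (I1 - I2) * min (y / x) (c / x)) = I2 * y + (I1 - I2) * min y c"
proof -
  have "min (y / x) (c / x) = min y c / x"
    using assms by (simp add: min_divide_distrib_right)
  then show ?thesis using assms by (simp add: field_simps)
qed

context transient_change_model
begin

subsection \<open>Likelihood ratios and change of measure\<close>

declare One_nat_def [simp del]

text \<open>Meaningful only for \<open>v \<le> j\<close>; before the change the law is
  \<open>f0\<close>, and that case is separated out wherever it arises.\<close>

definition post_density :: "nat \<Rightarrow> nat \<Rightarrow> nat \<Rightarrow> 's \<Rightarrow> real" where
  "post_density d v j x = (if j < v + d then f1 x else f2 x)"

definition lr :: "nat \<Rightarrow> nat \<Rightarrow> nat \<Rightarrow> 's \<Rightarrow> real" where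
  "lr d v j x = post_density d v j x / f0 x"

definition F :: "nat \<Rightarrow> 'w measure" where
  "F n = obs_filtration (space Pinf) \<mu> X (enat n)"

lemma post_density_measurable [measurable]: "post_density d v j \<in> borel_measurable \<mu>"
  unfolding post_density_def using density_measurable by simp

lemma lr_measurable [measurable]: "lr d v j \<in> borel_measurable \<mu>"
  unfolding lr_def using density_measurable by simp

lemma lr_nonneg: "x \<in> space \<mu> \<Longrightarrow> 0 \<le> lr d v j x"
  unfolding lr_def post_density_def using density_nonneg by simp

lemma X_measurable [measurable]: "1 \<le> k \<Longrightarrow> X k \<in> measurable Pinf \<mu>"
  using distr_Pinf distributed_measurable by blast

lemma X_measurable_P [measurable]: "1 \<le> v \<Longrightarrow> 1 \<le> k \<Longrightarrow> X k \<in> measurable (P d v) \<mu>"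
  using distr_P distributed_measurable by blast

lemma space_P: "1 \<le> v \<Longrightarrow> space (P d v) = space Pinf"
  by (rule sets_eq_imp_space_eq) (rule sets_P)

lemma X_space: "1 \<le> k \<Longrightarrow> \<omega> \<in> space Pinf \<Longrightarrow> X k \<omega> \<in> space \<mu>"
  using X_measurable measurable_space by metis

lemma obs_gen_subset:
  "{X j -` A \<inter> space Pinf | j A. 1 \<le> j \<and> enat j \<le> t \<and> A \<in> sets \<mu>} \<subseteq> Pow (space Pinf)"
  by auto

lemma space_F [simp]: "space (F n) = space Pinf"
  unfolding F_def obs_filtration_def by (simp add: space_measure_of_conv)

lemma sets_obs: "sets (obs_filtration (space Pinf) \<mu> X t) =
    sigma_sets (space Pinf) {X j -` A \<inter> space Pinf | j A. 1 \<le> j \<and> enat j \<le> t \<and> A \<in> sets \<mu>}"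
  unfolding F_def obs_filtration_def by (rule sets_measure_of[OF obs_gen_subset])

lemma sets_obs_subset: "sets (obs_filtration (space Pinf) \<mu> X t) \<subseteq> sets Pinf"
  unfolding sets_obs by (rule sets.sigma_sets_subset) auto

lemma sets_F_subset: "sets (F n) \<subseteq> sets Pinf"
  unfolding F_def by (rule sets_obs_subset)

lemma sets_F_mono:
  assumes "m \<le> n"
  shows "sets (F m) \<subseteq> sets (F n)"
proof -
  have "enat j \<le> enat n" if "enat j \<le> enat m" for j
    using that assms by simp
  then show ?thesis
    unfolding F_def sets_obs by (intro sigma_sets_mono') blast
qed

lemma X_measurable_F [measurable]:
  assumes "1 \<le> j" "j \<le> n"
  shows "X j \<in> measurable (F n) \<mu>"
proof (rule measurableI)
  fix B assume "B \<in> sets \<mu>"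
  with assms have "X j -` B \<inter> space Pinf \<in>
      {X j -` A \<inter> space Pinf | j A. 1 \<le> j \<and> enat j \<le> enat n \<and> A \<in> sets \<mu>}"
    unfolding mem_Collect_eq by (intro exI[of _ j] exI[of _ B]) auto
  then show "X j -` B \<inter> space (F n) \<in> sets (F n)"
    unfolding space_F by (simp only: F_def sets_obs sigma_sets.Basic)
qed (use assms X_space in auto)

text \<open>The generated sigma-algebra is the pullback of the finite product one. This turns
  statements about events of the past into statements about product spaces, where boxes determine a
  measure.\<close>

lemma sets_F_vimage:
  assumes "A \<in> sets (F n)"
  obtains B where "B \<in> sets (PiM {1..n} (\<lambda>_. \<mu>))"
    "A = (\<lambda>\<omega>. \<lambda>j\<in>{1..n}. X j \<omega>) -` B \<inter> space Pinf"
proof -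
  let ?R = "\<lambda>\<omega>. \<lambda>j\<in>{1..n}. X j \<omega>" and ?M = "PiM {1..n} (\<lambda>_. \<mu>)"
  have R: "?R \<in> space Pinf \<rightarrow> space ?M"
    by (auto simp: space_PiM X_space)
  have "X j -` A \<inter> space Pinf \<in> sets (vimage_algebra (space Pinf) ?R ?M)"
    if "1 \<le> j" "j \<le> n" "A \<in> sets \<mu>" for j A
  proof -
    have "X j -` A \<inter> space Pinf = ?R -` ((\<lambda>x. x j) -` A \<inter> space ?M) \<inter> space Pinf"
      using that R by auto
    moreover have "(\<lambda>x. x j) -` A \<inter> space ?M \<in> sets ?M"
      using that by (intro measurable_sets[of _ _ \<mu>] measurable_component_singleton) auto
    ultimately show ?thesis
      by (metis in_vimage_algebra)
  qed
  then have "sigma_sets (space (vimage_algebra (space Pinf) ?R ?M))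
      {X j -` A \<inter> space Pinf | j A. 1 \<le> j \<and> enat j \<le> enat n \<and> A \<in> sets \<mu>}
    \<subseteq> sets (vimage_algebra (space Pinf) ?R ?M)"
    by (intro sets.sigma_sets_subset) auto
  then have "sets (F n) \<subseteq> sets (vimage_algebra (space Pinf) ?R ?M)"
    unfolding F_def sets_obs by simp
  then show thesis
    using that assms sets_vimage_algebra2[OF R] by auto
qed

lemma distr_post_density:
  assumes "1 \<le> v" "1 \<le> k"
  shows "distributed (P d v) \<mu> (X k) (\<lambda>x. ennreal (if k < v then f0 x else post_density d v k x))"
proof -
  have "(\<lambda>x. ennreal (if k < v then f0 x else post_density d v k x)) =
    (\<lambda>x. ennreal (if k < v then f0 x else if k < v + d then f1 x else f2 x))"
    by (auto simp: post_density_def fun_eq_iff)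
  then show ?thesis using distr_P[OF assms, of d] by simp
qed

text \<open>Absolute continuity makes the convention \<open>x / 0 = 0\<close> harmless: where
  \<open>f0\<close> vanishes, the post-change density does too, up to a null set.\<close>

lemma post_density_lr: "AE x in \<mu>. post_density d v j x = f0 x * lr d v j x"
  using kl_finite(1,3) unfolding lr_def post_density_def by (cases "j < v + d") auto

text \<open>By independence both sides factor over boxes, and for a single coordinate the identity
  is the definition of the likelihood ratio. Boxes determine the joint law of the first
  \<open>n\<close> observations, and every event of \<open>F n\<close> is a pullback from
  it.\<close>

lemma change_of_measure:
  assumes A: "A \<in> sets (F n)" and v: "1 \<le> v"
  shows "emeasure (P d v) A =
    (\<integral>\<^sup>+\<omega>. ennreal (\<Prod>j\<in>{v..n}. lr d v j (X j \<omega>)) * indicator A \<omega> \<partial>Pinf)"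
proof -
  let ?R = "\<lambda>\<omega>. \<lambda>j\<in>{1..n}. X j \<omega>" and ?M = "PiM {1..n} (\<lambda>_. \<mu>)"
  \<comment> \<open>Before the change both laws have density \<open>f0\<close>, so those coordinates
    carry weight 1 and the final product starts at \<open>v\<close>.\<close>
  define w where "w j x = (if j < v then 1 else ennreal (lr d v j x))" for j x
  define W where "W y = (\<Prod>j\<in>{1..n}. w j (y j))" for y
  have w[measurable]: "w j \<in> borel_measurable \<mu>" for j
    unfolding w_def by simp
  have W[measurable]: "W \<in> borel_measurable ?M"
    unfolding W_def by measurable
  have R[measurable]: "?R \<in> measurable Pinf ?M" and R'[measurable]: "?R \<in> measurable (P d v) ?M"
    using v by (auto intro!: measurable_restrict)
  interpret Q: prob_space Pinf by (rule prob_space_Pinf)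
  interpret P: prob_space "P d v" using v by (rule prob_space_P)
  have eq: "distr (P d v) ?M ?R = density (distr Pinf ?M ?R) W"
  proof (rule measure_eqI_PiM_finite[where A="\<lambda>_. space ?M"])
    fix E :: "nat \<Rightarrow> 's set" assume E: "\<And>i. i \<in> {1..n} \<Longrightarrow> E i \<in> sets \<mu>"
    have box: "Pi\<^sub>E {1..n} E \<in> sets ?M"
      using E by (intro sets_PiM_I_finite) auto
    have ind: "(indicator (Pi\<^sub>E {1..n} E) (?R \<omega>) :: ennreal) = (\<Prod>j\<in>{1..n}. indicator (E j) (X j \<omega>))" for \<omega>
      by (auto simp: indicator_def PiE_iff)
    have 1: "(\<integral>\<^sup>+\<omega>. indicator (E j) (X j \<omega>) \<partial>P d v) = (\<integral>\<^sup>+\<omega>. w j (X j \<omega>) * indicator (E j) (X j \<omega>) \<partial>Pinf)"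
      if j: "j \<in> {1..n}" for j
    proof -
      note [measurable] = E[OF j]
      have "(\<integral>\<^sup>+\<omega>. indicator (E j) (X j \<omega>) \<partial>P d v) =
         (\<integral>\<^sup>+x. ennreal (if j < v then f0 x else post_density d v j x) * indicator (E j) x \<partial>\<mu>)"
        using j v by (intro distributed_nn_integral[OF distr_post_density, symmetric]) auto
      also have "\<dots> = (\<integral>\<^sup>+x. ennreal (f0 x) * (w j x * indicator (E j) x) \<partial>\<mu>)"
      proof (rule nn_integral_cong_AE)
        show "AE x in \<mu>. ennreal (if j < v then f0 x else post_density d v j x) * indicator (E j) x =
          ennreal (f0 x) * (w j x * indicator (E j) x)"
          using post_density_lr[of d v j] AE_space
        proof eventually_elim
          case (elim x)
          then show ?case
            using density_nonneg(1)[of x] lr_nonneg[of x d v j]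
            by (auto simp: w_def indicator_def ennreal_mult)
        qed
      qed
      also have "\<dots> = (\<integral>\<^sup>+\<omega>. w j (X j \<omega>) * indicator (E j) (X j \<omega>) \<partial>Pinf)"
        using j by (intro distributed_nn_integral[OF distr_Pinf]) auto
      finally show ?thesis .
    qed
    have "emeasure (distr (P d v) ?M ?R) (Pi\<^sub>E {1..n} E) = (\<integral>\<^sup>+y. indicator (Pi\<^sub>E {1..n} E) y \<partial>distr (P d v) ?M ?R)"
      using box by simp
    also have "\<dots> = (\<integral>\<^sup>+\<omega>. (\<Prod>j\<in>{1..n}. indicator (E j) (X j \<omega>)) \<partial>P d v)"
      unfolding ind[symmetric] using box by (intro nn_integral_distr R') auto
    also have "\<dots> = (\<Prod>j\<in>{1..n}. \<integral>\<^sup>+\<omega>. indicator (E j) (X j \<omega>) \<partial>P d v)"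
      using E by (intro P.indep_vars_nn_integral P.indep_vars_compose2[OF P.indep_vars_subset[OF indep_P[OF v]]]) auto
    also have "\<dots> = (\<Prod>j\<in>{1..n}. \<integral>\<^sup>+\<omega>. w j (X j \<omega>) * indicator (E j) (X j \<omega>) \<partial>Pinf)"
      using 1 by (intro prod.cong) auto
    also have "\<dots> = (\<integral>\<^sup>+\<omega>. (\<Prod>j\<in>{1..n}. w j (X j \<omega>) * indicator (E j) (X j \<omega>)) \<partial>Pinf)"
      using E by (intro Q.indep_vars_nn_integral[symmetric] Q.indep_vars_compose2[OF Q.indep_vars_subset[OF indep_Pinf]]) auto
    also have "\<dots> = (\<integral>\<^sup>+\<omega>. W (?R \<omega>) * indicator (Pi\<^sub>E {1..n} E) (?R \<omega>) \<partial>Pinf)"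
      by (intro nn_integral_cong) (simp add: ind W_def prod.distrib)
    also have "\<dots> = (\<integral>\<^sup>+y. W y * indicator (Pi\<^sub>E {1..n} E) y \<partial>distr Pinf ?M ?R)"
      using box by (subst nn_integral_distr) auto
    also have "\<dots> = emeasure (density (distr Pinf ?M ?R) W) (Pi\<^sub>E {1..n} E)"
      using box by (subst emeasure_density) auto
    finally show "emeasure (distr (P d v) ?M ?R) (Pi\<^sub>E {1..n} E) =
      emeasure (density (distr Pinf ?M ?R) W) (Pi\<^sub>E {1..n} E)" .
  next
    have "Pi\<^sub>E {1..n} (\<lambda>_. space \<mu>) \<in> prod_algebra {1..n} (\<lambda>_. \<mu>)"
      by (rule prod_algebraI_finite) auto
    then show "range (\<lambda>_::nat. space ?M) \<subseteq> prod_algebra {1..n} (\<lambda>_. \<mu>)"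
      by (auto simp: space_PiM)
    show "emeasure (distr (P d v) ?M ?R) (space ?M) \<noteq> \<infinity>"
      by (subst emeasure_distr) (auto simp: P.emeasure_eq_measure)
  qed auto
  obtain B where B: "B \<in> sets ?M" and AB: "A = ?R -` B \<inter> space Pinf"
    using sets_F_vimage[OF A] .
  have "emeasure (P d v) A = emeasure (distr (P d v) ?M ?R) B"
    using B R' by (subst emeasure_distr) (auto simp: AB space_P[OF v])
  also have "\<dots> = (\<integral>\<^sup>+\<omega>. W (?R \<omega>) * indicator B (?R \<omega>) \<partial>Pinf)"
    unfolding eq using B by (subst emeasure_density) (auto simp: nn_integral_distr)
  also have "\<dots> = (\<integral>\<^sup>+\<omega>. ennreal (\<Prod>j\<in>{v..n}. lr d v j (X j \<omega>)) * indicator A \<omega> \<partial>Pinf)"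
  proof (rule nn_integral_cong)
    fix \<omega> assume \<omega>: "\<omega> \<in> space Pinf"
    have "W (?R \<omega>) = (\<Prod>j\<in>{1..n}. w j (X j \<omega>))"
      unfolding W_def by simp
    also have "\<dots> = (\<Prod>j\<in>{v..n}. w j (X j \<omega>))"
      using v by (intro prod.mono_neutral_right) (auto simp: w_def)
    also have "\<dots> = (\<Prod>j\<in>{v..n}. ennreal (lr d v j (X j \<omega>)))"
      by (intro prod.cong) (auto simp: w_def)
    also have "\<dots> = ennreal (\<Prod>j\<in>{v..n}. lr d v j (X j \<omega>))"
      using \<omega> v by (intro prod_ennreal lr_nonneg X_space) auto
    finally show "W (?R \<omega>) * indicator B (?R \<omega>) =
      ennreal (\<Prod>j\<in>{v..n}. lr d v j (X j \<omega>)) * indicator A \<omega>"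
      using \<omega> by (auto simp: AB indicator_def)
  qed
  finally show ?thesis .
qed

lemma indep_future:
  assumes A: "A \<in> sets (F n)" and v: "1 \<le> v" and J: "J \<subseteq> {n<..}"
    and B: "B \<in> sets (PiM J (\<lambda>_. \<mu>))"
  shows "measure (P d v) (A \<inter> {\<omega> \<in> space Pinf. (\<lambda>j\<in>J. X j \<omega>) \<in> B}) =
    measure (P d v) A * measure (P d v) {\<omega> \<in> space Pinf. (\<lambda>j\<in>J. X j \<omega>) \<in> B}"
proof -
  let ?R = "\<lambda>\<omega>. \<lambda>j\<in>{1..n}. X j \<omega>" and ?M = "PiM {1..n} (\<lambda>_. \<mu>)"
  interpret P: prob_space "P d v" using v by (rule prob_space_P)
  obtain C where C: "C \<in> sets ?M" and AC: "A = ?R -` C \<inter> space Pinf"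
    using sets_F_vimage[OF A] .
  have "P.indep_var ?M ?R (PiM J (\<lambda>_. \<mu>)) (\<lambda>\<omega>. \<lambda>j\<in>J. X j \<omega>)"
    using J by (intro P.indep_var_restrict[OF indep_P[OF v]]) auto
  from P.indep_varD[OF this C B] show ?thesis
    unfolding AC space_P[OF v] by (simp add: vimage_def Int_def conj_ac)
qed

text \<open>The post-change density is \<open>f0\<close> times the ratio, so points with ratio 0
  carry no mass under the post-change law. Hence the default \<open>ln 0 = 0\<close> only matters on
  a null set.\<close>

lemma lr_pos_AE:
  assumes "1 \<le> v" "v \<le> j"
  shows "AE \<omega> in P d v. 0 < lr d v j (X j \<omega>)"
proof -
  have m: "{x \<in> space \<mu>. 0 < lr d v j x} \<in> sets \<mu>" by measurable
  have "AE x in density \<mu> (\<lambda>x. ennreal (if j < v then f0 x else post_density d v j x)). 0 < lr d v j x"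
  proof (subst AE_density)
    show "AE x in \<mu>. 0 < ennreal (if j < v then f0 x else post_density d v j x) \<longrightarrow> 0 < lr d v j x"
      using post_density_lr[of d v j] AE_space
    proof eventually_elim
      case (elim x)
      then show ?case using assms lr_nonneg[of x d v j] by (cases "lr d v j x = 0") auto
    qed
  qed (use assms density_measurable in auto)
  then have "AE x in distr (P d v) \<mu> (X j). 0 < lr d v j x"
    by (subst distributed_distr_eq_density[OF distr_post_density[of v j d]]) (use assms in auto)
  then show ?thesis
    using assms m by (subst (asm) AE_distr_iff) auto
qed

subsection \<open>Laws of large numbers for log-likelihood ratios\<close>

definition kl :: "nat \<Rightarrow> nat \<Rightarrow> nat \<Rightarrow> real" where
  "kl d v j = (if j < v + d then kl_number \<mu> f1 f0 else kl_number \<mu> f2 f0)"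

text \<open>Markov's inequality applied to the mean absolute deviation. The constant
  \<open>C\<close> depends on \<eta> alone: a truncation level \<open>N\<close> that works for both
  post-change laws works for every \<open>d\<close>, \<open>v\<close> and block.\<close>

lemma llr_deviation:
  assumes \<eta>: "0 < \<eta>"
  obtains C where "0 < C"
    "\<And>d v s n t. 1 \<le> v \<Longrightarrow> v \<le> s \<Longrightarrow> 0 < t \<Longrightarrow>
      measure (P d v) {\<omega> \<in> space Pinf. t \<le> \<bar>\<Sum>j\<in>{s..<s+n}. ln (lr d v j (X j \<omega>)) - kl d v j\<bar>}
        \<le> (C + \<eta> * n) / t"
proof -
  \<comment> \<open>Compensates the factor 3 in front of the slope in
    \<open>expectation_abs_indep_sum\<close>.\<close>
  define \<eta>' where "\<eta>' = \<eta> / 3"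
  have \<eta>': "0 < \<eta>'" using \<eta> by (simp add: \<eta>'_def)
  note [measurable] = density_measurable
  have "\<forall>\<^sub>F n in sequentially. 0 < n \<and>
      (\<integral>x. (if real n < \<bar>ln (f1 x / f0 x)\<bar> then \<bar>f1 x * ln (f1 x / f0 x)\<bar> else 0) \<partial>\<mu>) < \<eta>' \<and>
      (\<integral>x. (if real n < \<bar>ln (f2 x / f0 x)\<bar> then \<bar>f2 x * ln (f2 x / f0 x)\<bar> else 0) \<partial>\<mu>) < \<eta>'"
    by (intro eventually_conj tail_integral_small kl_finite \<eta>' eventually_gt_at_top) measurable
  then obtain N :: nat where N: "0 < N"
      "(\<integral>x. (if real N < \<bar>ln (f1 x / f0 x)\<bar> then \<bar>f1 x * ln (f1 x / f0 x)\<bar> else 0) \<partial>\<mu>) < \<eta>'"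
      "(\<integral>x. (if real N < \<bar>ln (f2 x / f0 x)\<bar> then \<bar>f2 x * ln (f2 x / f0 x)\<bar> else 0) \<partial>\<mu>) < \<eta>'"
    by (auto simp: eventually_sequentially)
  define C where "C = (real N)\<^sup>2 / \<eta>'"
  show thesis
  proof (rule that)
    show "0 < C" using N \<eta>' by (simp add: C_def)
    fix d v s n :: nat and t :: real assume v: "1 \<le> v" "v \<le> s" and t: "0 < t"
    interpret P: prob_space "P d v" using v(1) by (rule prob_space_P)
    define Y where "Y j \<omega> = ln (lr d v j (X j \<omega>))" for j \<omega>
    have pd: "distributed (P d v) \<mu> (X j) (\<lambda>x. ennreal (post_density d v j x))" if "s \<le> j" for j
      using distr_post_density[of v j d] v that by (simp add: not_less)
    have pd0: "0 \<le> post_density d v j x" if "x \<in> space \<mu>" for j x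
      using density_nonneg that by (simp add: post_density_def)
    have int\<mu>: "integrable \<mu> (\<lambda>x. post_density d v j x * ln (lr d v j x))" for j
      using kl_finite unfolding post_density_def lr_def by (cases "j < v + d") auto
    have int: "integrable (P d v) (Y j)" if "s \<le> j" for j
      using distributed_integrable[OF pd[OF that], of "\<lambda>x. ln (lr d v j x)"] int\<mu> pd0
      unfolding Y_def by auto
    have EY: "P.expectation (Y j) = kl d v j" if "s \<le> j" for j
    proof -
      have "P.expectation (Y j) = (\<integral>x. post_density d v j x * ln (lr d v j x) \<partial>\<mu>)"
        unfolding Y_def by (rule distributed_integral[symmetric, OF pd[OF that]]) (use pd0 in auto)
      also have "\<dots> = kl d v j"
        unfolding kl_def kl_number_def post_density_def lr_def by simp
      finally show ?thesis .
    qed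
    have tail: "P.expectation (\<lambda>\<omega>. if N < \<bar>Y j \<omega>\<bar> then \<bar>Y j \<omega>\<bar> else 0) \<le> \<eta>'" if "s \<le> j" for j
    proof -
      have "P.expectation (\<lambda>\<omega>. if N < \<bar>Y j \<omega>\<bar> then \<bar>Y j \<omega>\<bar> else 0) =
        (\<integral>x. post_density d v j x * (if N < \<bar>ln (lr d v j x)\<bar> then \<bar>ln (lr d v j x)\<bar> else 0) \<partial>\<mu>)"
        unfolding Y_def by (rule distributed_integral[symmetric, OF pd[OF that]]) (use pd0 in auto)
      also have "\<dots> = (\<integral>x. (if N < \<bar>ln (lr d v j x)\<bar> then \<bar>post_density d v j x * ln (lr d v j x)\<bar> else 0) \<partial>\<mu>)"
        by (intro Bochner_Integration.integral_cong refl) (auto simp: abs_mult pd0)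
      also have "\<dots> \<le> \<eta>'"
      proof (cases "j < v + d")
        case True
        then show ?thesis using N(2) unfolding post_density_def lr_def if_P[OF True] by linarith
      next
        case False
        then show ?thesis using N(3) unfolding post_density_def lr_def if_not_P[OF False] by linarith
      qed
      finally show ?thesis .
    qed
    have indY: "P.indep_vars (\<lambda>_. borel) Y {s..<s+n}"
      unfolding Y_def using v by (intro P.indep_vars_compose2[OF P.indep_vars_subset[OF indep_P[OF v(1)]]]) auto
    define S where "S \<omega> = (\<Sum>j\<in>{s..<s+n}. Y j \<omega> - P.expectation (Y j))" for \<omega>
    have ES: "P.expectation (\<lambda>\<omega>. \<bar>S \<omega>\<bar>) \<le> C + \<eta> * n"
      using P.expectation_abs_indep_sum[OF _ indY int tail _ \<eta>'] N(1)
      unfolding S_def C_def \<eta>'_def by simp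
    have intS: "integrable (P d v) S"
      unfolding S_def by (intro Bochner_Integration.integrable_sum Bochner_Integration.integrable_diff int) auto
    have "{\<omega> \<in> space Pinf. t \<le> \<bar>\<Sum>j\<in>{s..<s+n}. ln (lr d v j (X j \<omega>)) - kl d v j\<bar>} =
        {\<omega> \<in> space (P d v). t \<le> \<bar>S \<omega>\<bar>}"
      unfolding S_def Y_def[symmetric] space_P[OF v(1)] by (simp add: EY)
    also have "measure (P d v) \<dots> \<le> P.expectation (\<lambda>\<omega>. \<bar>S \<omega>\<bar>) / t"
      using intS t by (intro integral_Markov_inequality_measure[where A="{}"]) auto
    also have "\<dots> \<le> (C + \<eta> * n) / t"
      using ES t by (intro divide_right_mono) auto
    finally show "measure (P d v) {\<omega> \<in> space Pinf. t \<le> \<bar>\<Sum>j\<in>{s..<s+n}. ln (lr d v j (X j \<omega>)) - kl d v j\<bar>}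
        \<le> (C + \<eta> * n) / t" .
  qed
qed

subsection \<open>Lower bound on the delay\<close>

abbreviation stop :: "('w \<Rightarrow> enat) \<Rightarrow> bool" where
  "stop \<tau> \<equiv> stopping_time (obs_filtration (space Pinf) \<mu> X) \<tau>"

lemma stop_le_sets:
  assumes "stop \<tau>"
  shows "{\<omega> \<in> space Pinf. \<tau> \<omega> \<le> enat n} \<in> sets (F n)"
proof -
  have "Measurable.pred (F n) (\<lambda>\<omega>. \<tau> \<omega> \<le> enat n)"
    unfolding F_def using assms by (rule stopping_timeD)
  then show ?thesis by (simp add: pred_def)
qed

lemma stop_gt_sets:
  assumes "stop \<tau>"
  shows "{\<omega> \<in> space Pinf. enat n < \<tau> \<omega>} \<in> sets (F n)"
proof -
  have "{\<omega> \<in> space Pinf. enat n < \<tau> \<omega>} = space (F n) - {\<omega> \<in> space Pinf. \<tau> \<omega> \<le> enat n}"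
    by auto
  then show ?thesis using sets.compl_sets[OF stop_le_sets[OF assms]] by metis
qed

lemma enat_le_iff_pred: "1 \<le> v \<Longrightarrow> enat v \<le> t \<longleftrightarrow> enat (v - 1) < t"
  by (cases t) auto

text \<open>Not having stopped by time \<open>v - 1\<close> is decided before the change. The lower
  bound and the comparison of the two criteria both depend on this index
  \<open>v - 1\<close>.\<close>

lemma stop_ge_sets:
  assumes "stop \<tau>" "1 \<le> v"
  shows "{\<omega> \<in> space Pinf. enat v \<le> \<tau> \<omega>} \<in> sets (F (v - 1))"
  using stop_gt_sets[OF assms(1), of "v - 1"] assms(2) by (simp add: enat_le_iff_pred)

lemma stop_window_sets:
  assumes "stop \<tau>" "1 \<le> v" "1 \<le> m"
  shows "{\<omega> \<in> space Pinf. enat v \<le> \<tau> \<omega> \<and> \<tau> \<omega> < enat (v + m)} \<in> sets (F (v + m - 1))"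
proof -
  have "{\<omega> \<in> space Pinf. enat v \<le> \<tau> \<omega> \<and> \<tau> \<omega> < enat (v + m)} =
    {\<omega> \<in> space Pinf. enat v \<le> \<tau> \<omega>} - {\<omega> \<in> space Pinf. enat (v + m) \<le> \<tau> \<omega>}"
    by auto
  moreover have "{\<omega> \<in> space Pinf. enat v \<le> \<tau> \<omega>} \<in> sets (F (v + m - 1))"
    using stop_ge_sets[OF assms(1,2)] sets_F_mono[of "v - 1" "v + m - 1"] by (simp add: subset_iff)
  moreover have "{\<omega> \<in> space Pinf. enat (v + m) \<le> \<tau> \<omega>} \<in> sets (F (v + m - 1))"
    using assms by (intro stop_ge_sets) auto
  ultimately show ?thesis by (simp add: sets.Diff)
qed

lemma stop_measurable:
  assumes "stop \<tau>"
  shows "\<tau> \<in> measurable Pinf (count_space UNIV)"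
proof -
  have gt[measurable]: "Measurable.pred Pinf (\<lambda>\<omega>. enat n < \<tau> \<omega>)" for n
    using stop_gt_sets[OF assms, of n] sets_F_subset[of n] unfolding pred_def by auto
  have le[measurable]: "Measurable.pred Pinf (\<lambda>\<omega>. \<tau> \<omega> \<le> enat n)" for n
    using stop_le_sets[OF assms, of n] sets_F_subset[of n] unfolding pred_def by auto
  have "Measurable.pred Pinf (\<lambda>\<omega>. \<tau> \<omega> = t)" for t
  proof (cases t)
    case (enat n)
    have "(\<tau> \<omega> = t) \<longleftrightarrow> \<tau> \<omega> \<le> enat n \<and> (\<forall>k<n. enat k < \<tau> \<omega>)" for \<omega>
    proof (cases "\<tau> \<omega>")
      case (enat i)
      moreover have "i = n \<longleftrightarrow> i \<le> n \<and> (\<forall>k<n. k < i)"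
        by (metis le_neq_implies_less less_irrefl order_refl)
      ultimately show ?thesis using \<open>t = enat n\<close> by simp
    qed (simp add: \<open>t = enat n\<close>)
    then show ?thesis by simp
  next
    case infinity
    have "(\<tau> \<omega> = t) \<longleftrightarrow> (\<forall>n. enat n < \<tau> \<omega>)" for \<omega>
      using infinity by (cases "\<tau> \<omega>") auto
    then show ?thesis by simp
  qed
  then have "{\<omega> \<in> space Pinf. \<tau> \<omega> = t} \<in> sets Pinf" for t
    unfolding pred_def .
  then show ?thesis
    by (simp add: measurable_count_space_eq2_countable vimage_def Int_def conj_commute)
qed

lemma stop_measurable_P: "stop \<tau> \<Longrightarrow> 1 \<le> v \<Longrightarrow> \<tau> \<in> measurable (P d v) (count_space UNIV)"
  using stop_measurable measurable_cong_sets[OF sets_P refl] by blast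

lemma sets_F_P: "1 \<le> v \<Longrightarrow> A \<in> sets (F n) \<Longrightarrow> A \<in> sets (P d v)"
  using sets_F_subset sets_P by blast

lemma C_classD:
  assumes "\<tau> \<in> C_class \<mu> X Pinf \<gamma>"
  shows "stop \<tau>" "ennreal \<gamma> \<le> (\<integral>\<^sup>+\<omega>. ennreal_of_enat (\<tau> \<omega>) \<partial>Pinf)"
  using assms unfolding C_class_def by auto

text \<open>Averaging over window positions. If every window had a larger hazard, summing
  \<open>q k - q (k + m)\<close> over \<open>k\<close>, which gives at most \<open>m\<close>, would
  force the survival probabilities to sum to at most \<open>\<gamma> / 2\<close>. Their sum is the
  mean of \<tau>, which is at least \<gamma>; the factor 2 makes this a contradiction.\<close>

lemma small_hazard_window:
  assumes \<tau>: "\<tau> \<in> C_class \<mu> X Pinf \<gamma>" and \<gamma>: "0 < \<gamma>" and m: "1 \<le> m"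
  obtains v where "1 \<le> v" "0 < measure Pinf {\<omega> \<in> space Pinf. enat v \<le> \<tau> \<omega>}"
    "measure Pinf {\<omega> \<in> space Pinf. enat v \<le> \<tau> \<omega> \<and> \<tau> \<omega> < enat (v + m)}
      \<le> 2 * real m / \<gamma> * measure Pinf {\<omega> \<in> space Pinf. enat v \<le> \<tau> \<omega>}"
proof (rule ccontr)
  assume "\<not> thesis"
  interpret Q: prob_space Pinf by (rule prob_space_Pinf)
  note st = C_classD(1)[OF \<tau>]
  define q where "q k = measure Pinf {\<omega> \<in> space Pinf. enat k < \<tau> \<omega>}" for k
  have sets: "{\<omega> \<in> space Pinf. enat k < \<tau> \<omega>} \<in> sets Pinf" for k
    using stop_gt_sets[OF st] sets_F_subset by blast
  have hazard: "2 * real m / \<gamma> * q k \<le> q k - q (k + m)" for k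
  proof -
    have subset: "{\<omega> \<in> space Pinf. enat (k + m) < \<tau> \<omega>} \<subseteq> {\<omega> \<in> space Pinf. enat k < \<tau> \<omega>}"
      by (auto intro: order.strict_trans1[of "enat k" "enat (k + m)"])
    have eq: "{\<omega> \<in> space Pinf. enat (Suc k) \<le> \<tau> \<omega>} = {\<omega> \<in> space Pinf. enat k < \<tau> \<omega>}"
      by (auto simp: enat_le_iff_pred)
    have "{\<omega> \<in> space Pinf. enat (Suc k) \<le> \<tau> \<omega> \<and> \<tau> \<omega> < enat (Suc k + m)} =
      {\<omega> \<in> space Pinf. enat k < \<tau> \<omega>} - {\<omega> \<in> space Pinf. enat (k + m) < \<tau> \<omega>}"
      by (auto simp: enat_le_iff_pred) (metis Suc_ile_eq not_less)+
    then have window: "measure Pinf {\<omega> \<in> space Pinf. enat (Suc k) \<le> \<tau> \<omega> \<and> \<tau> \<omega> < enat (Suc k + m)} = q k - q (k + m)"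
      unfolding q_def using sets
      by (simp add: Q.finite_measure_Diff subset)
    \<comment> \<open>The negated claim speaks only of windows reached with positive probability;
      for the others both sides of the inequality are 0.\<close>
    show ?thesis
    proof (cases "q k = 0")
      case True
      have "q (k + m) \<le> q k"
        unfolding q_def using sets subset by (intro Q.finite_measure_mono) auto
      then show ?thesis using True by simp
    next
      case False
      then have "0 < q k" unfolding q_def by (simp add: zero_less_measure_iff)
      then show ?thesis
        using \<open>\<not> thesis\<close> that[of "Suc k"] window unfolding eq q_def[symmetric] by fastforce
    qed
  qed
  have "(\<Sum>k<N. q k) \<le> \<gamma> / 2" for N
  proof -
    have "2 * real m / \<gamma> * (\<Sum>k<N. q k) \<le> (\<Sum>k<N. q k - q (k + m))"
      unfolding sum_distrib_left by (intro sum_mono hazard)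
    also have "\<dots> \<le> m"
      by (rule sum_shift_le) (auto simp: q_def)
    finally show ?thesis using \<gamma> m by (simp add: field_simps)
  qed
  then have "(\<Sum>k<N. ennreal (q k)) \<le> ennreal (\<gamma> / 2)" for N
    by (subst sum_ennreal) (auto simp: q_def intro!: ennreal_leI)
  then have "(\<Sum>k. ennreal (q k)) \<le> ennreal (\<gamma> / 2)"
    by (intro suminf_le_const) auto
  moreover have "(\<integral>\<^sup>+\<omega>. ennreal_of_enat (\<tau> \<omega>) \<partial>Pinf) = (\<Sum>k. ennreal (q k))"
    using nn_integral_enat_function[OF stop_measurable[OF st]] unfolding q_def
    by (simp add: Q.emeasure_eq_measure)
  ultimately have "ennreal \<gamma> \<le> ennreal (\<gamma> / 2)"
    using C_classD(2)[OF \<tau>] by simp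
  then show False using \<gamma> by (simp add: ennreal_le_iff)
qed

text \<open>The likelihood ratio is the product over \<open>{v..v - 1}\<close>, which is
  empty.\<close>

lemma measure_P_past:
  assumes "A \<in> sets (F (v - 1))" "1 \<le> v"
  shows "measure (P d v) A = measure Pinf A"
proof -
  have "emeasure (P d v) A = emeasure Pinf A"
    using change_of_measure[OF assms, of d] assms sets_F_subset[of "v - 1"] by (simp add: subset_iff)
  then show ?thesis by (simp add: measure_def)
qed

lemma lr_prod_measurable_F:
  assumes "1 \<le> s" "t \<le> Suc n"
  shows "(\<lambda>\<omega>. \<Prod>j\<in>{s..<t}. lr d v j (X j \<omega>)) \<in> borel_measurable (F n)"
  using assms by (intro borel_measurable_prod measurable_compose[OF X_measurable_F lr_measurable]) auto

text \<open>Where the likelihood ratio is at most \<open>exp a\<close>, the change of measure costs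
  at most that factor; the rest of \<open>A\<close> is kept as it is.\<close>

lemma measure_P_le:
  assumes A: "A \<in> sets (F n)" and v: "1 \<le> v"
  shows "measure (P d v) A \<le> exp a * measure Pinf A +
    measure (P d v) (A \<inter> {\<omega> \<in> space Pinf. exp a < (\<Prod>j\<in>{v..<Suc n}. lr d v j (X j \<omega>))})"
proof -
  interpret Q: prob_space Pinf by (rule prob_space_Pinf)
  interpret P: prob_space "P d v" using v by (rule prob_space_P)
  define L where "L \<omega> = (\<Prod>j\<in>{v..<Suc n}. lr d v j (X j \<omega>))" for \<omega>
  have [measurable]: "L \<in> borel_measurable (F n)"
    unfolding L_def using v by (rule lr_prod_measurable_F) simp
  define G where "G = {\<omega> \<in> space Pinf. exp a < L \<omega>}"
  have "{\<omega> \<in> space (F n). exp a < L \<omega>} \<in> sets (F n)" by measurable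
  then have G: "G \<in> sets (F n)" by (simp add: G_def)
  have AG: "A - G \<in> sets (F n)" "A \<inter> G \<in> sets (F n)" using A G by auto
  have A': "A \<in> sets Pinf" using A sets_F_subset by blast
  have "emeasure (P d v) (A - G) = (\<integral>\<^sup>+\<omega>. ennreal (L \<omega>) * indicator (A - G) \<omega> \<partial>Pinf)"
    using change_of_measure[OF AG(1) v] unfolding L_def atLeastLessThanSuc_atLeastAtMost .
  also have "\<dots> \<le> (\<integral>\<^sup>+\<omega>. ennreal (exp a) * indicator A \<omega> \<partial>Pinf)"
    by (intro nn_integral_mono) (auto simp: G_def indicator_def not_less intro!: ennreal_leI)
  also have "\<dots> = ennreal (exp a) * emeasure Pinf A"
    using A' by (simp add: nn_integral_cmult)
  also have "\<dots> = ennreal (exp a * measure Pinf A)"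
    by (simp add: Q.emeasure_eq_measure ennreal_mult)
  finally have "measure (P d v) (A - G) \<le> exp a * measure Pinf A"
    by (simp add: P.emeasure_eq_measure ennreal_le_iff)
  moreover have "measure (P d v) A = measure (P d v) (A - G) + measure (P d v) (A \<inter> G)"
    using AG v by (subst P.finite_measure_Union[symmetric]) (auto simp: sets_F_P Un_Diff_Int)
  ultimately show ?thesis unfolding G_def L_def by simp
qed

text \<open>A product instead of a sum of logarithms, since with \<open>ln 0 = 0\<close> a vanishing
  factor would count as neutral. The strict inequality matches the strict crossing in
  \<open>dcusum\<close>.\<close>

definition block_gt :: "nat \<Rightarrow> nat \<Rightarrow> nat \<Rightarrow> nat \<Rightarrow> real \<Rightarrow> 'w set" where
  "block_gt d v s n a = {\<omega> \<in> space Pinf. exp a < (\<Prod>j\<in>{s..<s+n}. lr d v j (X j \<omega>))}"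

lemma block_gt_sets_F:
  assumes "1 \<le> s" "s + n \<le> Suc N"
  shows "block_gt d v s n a \<in> sets (F N)"
proof -
  note [measurable] = lr_prod_measurable_F[OF assms]
  have "{\<omega> \<in> space (F N). exp a < (\<Prod>j\<in>{s..<s+n}. lr d v j (X j \<omega>))} \<in> sets (F N)"
    by measurable
  then show ?thesis by (simp add: block_gt_def)
qed

lemma indep_block_gt:
  assumes A: "A \<in> sets (F N)" and v: "1 \<le> v" and s: "N < s"
  shows "measure (P d v) (A \<inter> block_gt d v s n a) = measure (P d v) A * measure (P d v) (block_gt d v s n a)"
proof -
  let ?J = "{s..<s+n}"
  let ?B = "{x \<in> space (PiM ?J (\<lambda>_. \<mu>)). exp a < (\<Prod>j\<in>?J. lr d v j (x j))}"
  have "?B \<in> sets (PiM ?J (\<lambda>_. \<mu>))" by measurable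
  moreover have "block_gt d v s n a = {\<omega> \<in> space Pinf. (\<lambda>j\<in>?J. X j \<omega>) \<in> ?B}"
    unfolding block_gt_def using s by (auto simp: space_PiM X_space)
  moreover have "?J \<subseteq> {N<..}" using s by auto
  ultimately show ?thesis using indep_future[OF A v, of ?J ?B d] by metis
qed

text \<open>With the change placed at the start of a low-hazard window, no alarm inside the window
  means a delay of at least \<open>m\<close>. Given \<tau> \<ge> \<open>v\<close>, an alarm inside
  has probability at most the hazard inflated by \<open>exp a\<close>, plus \<beta> for an
  untypically large likelihood ratio.\<close>

lemma pollak_delay_ge:
  assumes \<tau>: "\<tau> \<in> C_class \<mu> X Pinf \<gamma>" and \<gamma>: "0 < \<gamma>" and m: "1 \<le> m"
    and \<beta>: "\<And>v. 1 \<le> v \<Longrightarrow> measure (P d v) (block_gt d v v m a) \<le> \<beta>"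
  shows "ennreal (m * (1 - (exp a * (2 * real m / \<gamma>) + \<beta>))) \<le> pollak_delay P d \<tau>"
proof -
  note st = C_classD(1)[OF \<tau>]
  obtain v where v: "1 \<le> v" and pos: "0 < measure Pinf {\<omega> \<in> space Pinf. enat v \<le> \<tau> \<omega>}"
    and haz: "measure Pinf {\<omega> \<in> space Pinf. enat v \<le> \<tau> \<omega> \<and> \<tau> \<omega> < enat (v + m)}
      \<le> 2 * real m / \<gamma> * measure Pinf {\<omega> \<in> space Pinf. enat v \<le> \<tau> \<omega>}"
    using small_hazard_window[OF \<tau> \<gamma> m] .
  interpret P: prob_space "P d v" using v by (rule prob_space_P)
  define B where "B = {\<omega> \<in> space Pinf. enat v \<le> \<tau> \<omega>}"
  define A where "A = {\<omega> \<in> space Pinf. enat v \<le> \<tau> \<omega> \<and> \<tau> \<omega> < enat (v + m)}"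
  have B: "B \<in> sets (F (v - 1))" and A: "A \<in> sets (F (v + m - 1))"
    unfolding A_def B_def using stop_ge_sets[OF st v] stop_window_sets[OF st v m] .
  have [measurable]: "B \<in> sets (P d v)" "A \<in> sets (P d v)"
    using A B v by (auto simp: sets_F_P)
  have AB: "A \<subseteq> B" by (auto simp: A_def B_def)
  note [measurable] = stop_measurable_P[OF st v]
  have PB: "measure (P d v) B = measure Pinf B"
    by (rule measure_P_past[OF B v])
  have PB_pos: "0 < measure (P d v) B" using pos PB by (simp add: B_def)
  have G: "block_gt d v v m a \<in> sets (P d v)"
    using v by (intro sets_F_P[OF v block_gt_sets_F[where N="v + m"]]) auto
  have "measure (P d v) A \<le> exp a * measure Pinf A + measure (P d v) (A \<inter> block_gt d v v m a)"
    using measure_P_le[OF A v, of d a] m by (simp add: block_gt_def)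
  \<comment> \<open>\<open>A\<close> depends on the observations of the window and hence on the
    block event. Enlarging it to \<open>B\<close>, which is decided before \<open>v\<close>,
    restores independence, so that dividing by the probability of \<open>B\<close> leaves just
    \<beta>.\<close>
  also have "measure (P d v) (A \<inter> block_gt d v v m a) \<le> measure (P d v) (B \<inter> block_gt d v v m a)"
  proof (rule P.finite_measure_mono)
    show "A \<inter> block_gt d v v m a \<subseteq> B \<inter> block_gt d v v m a"
      by (auto simp: A_def B_def)
  qed (use G in auto)
  also have "\<dots> = measure (P d v) B * measure (P d v) (block_gt d v v m a)"
    using v by (intro indep_block_gt[OF B v]) auto
  also have "\<dots> \<le> measure (P d v) B * \<beta>"
    by (intro mult_left_mono \<beta> v) auto
  also have "exp a * measure Pinf A \<le> exp a * (2 * real m / \<gamma> * measure (P d v) B)"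
    using haz unfolding A_def[symmetric] B_def[symmetric] PB by (intro mult_left_mono) auto
  finally have PA: "measure (P d v) A \<le> measure (P d v) B * (exp a * (2 * real m / \<gamma>) + \<beta>)"
    by (simp add: algebra_simps)
  have "ennreal (m * (1 - (exp a * (2 * real m / \<gamma>) + \<beta>))) * emeasure (P d v) B =
    ennreal (m * (1 - (exp a * (2 * real m / \<gamma>) + \<beta>)) * measure (P d v) B)"
    by (simp add: P.emeasure_eq_measure ennreal_mult'')
  also have "\<dots> \<le> ennreal (m * (measure (P d v) B - measure (P d v) A))"
  proof (rule ennreal_leI)
    have "m * ((1 - (exp a * (2 * real m / \<gamma>) + \<beta>)) * measure (P d v) B) \<le> m * (measure (P d v) B - measure (P d v) A)"
      using PA by (intro mult_left_mono) (auto simp: algebra_simps)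
    then show "m * (1 - (exp a * (2 * real m / \<gamma>) + \<beta>)) * measure (P d v) B \<le> m * (measure (P d v) B - measure (P d v) A)"
      by (simp add: mult.assoc)
  qed
  also have "\<dots> = ennreal (m * measure (P d v) (B - A))"
    using AB by (subst P.finite_measure_Diff) auto
  also have "\<dots> = (\<integral>\<^sup>+\<omega>. of_nat m * indicator (B - A) \<omega> \<partial>P d v)"
    by (simp add: nn_integral_cmult P.emeasure_eq_measure ennreal_mult ennreal_of_nat_eq_real_of_nat)
  also have "\<dots> \<le> (\<integral>\<^sup>+\<omega>. ennreal_of_enat (\<tau> \<omega> - enat v) * indicator B \<omega> \<partial>P d v)"
  proof (rule nn_integral_mono)
    fix \<omega>
    show "of_nat m * indicator (B - A) \<omega> \<le> ennreal_of_enat (\<tau> \<omega> - enat v) * indicator B \<omega>"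
    proof (cases "\<omega> \<in> B - A")
      case True
      then have "enat (v + m) \<le> \<tau> \<omega>" by (auto simp: A_def B_def not_less)
      then have "of_nat m \<le> \<tau> \<omega> - enat v"
        by (cases "\<tau> \<omega>") (auto simp: of_nat_eq_enat)
      then show ?thesis using True by simp
    qed simp
  qed
  finally have le: "ennreal (m * (1 - (exp a * (2 * real m / \<gamma>) + \<beta>))) * emeasure (P d v) B \<le>
    (\<integral>\<^sup>+\<omega>. ennreal_of_enat (\<tau> \<omega> - enat v) * indicator B \<omega> \<partial>P d v)" .
  have B_eq: "{\<omega> \<in> space (P d v). enat v \<le> \<tau> \<omega>} = B"
    by (simp add: B_def space_P[OF v])
  have "ennreal (m * (1 - (exp a * (2 * real m / \<gamma>) + \<beta>))) \<le>
    (\<integral>\<^sup>+\<omega>. ennreal_of_enat (\<tau> \<omega> - enat v) * indicator B \<omega> \<partial>P d v) / emeasure (P d v) B"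
    using divide_right_mono_ennreal[OF le, of "emeasure (P d v) B"] PB_pos
    by (simp add: ennreal_mult_divide_eq P.emeasure_eq_measure)
  also have "\<dots> = (\<integral>\<^sup>+\<omega>. ennreal_of_enat (\<tau> \<omega> - enat v) \<partial>uniform_measure (P d v) B)"
    by (subst nn_integral_uniform_measure) auto
  also have "\<dots> \<le> pollak_delay P d \<tau>"
    unfolding pollak_delay_def using v PB_pos
    by (intro SUP_upper2[of v]) (auto simp: B_eq P.emeasure_eq_measure)
  finally show ?thesis .
qed

lemma subalgebra_F: "1 \<le> v \<Longrightarrow> subalgebra (P d v) (F n)"
  unfolding subalgebra_def using sets_F_subset sets_P space_P by simp

lemma sigma_finite_subalgebra_F:
  assumes "1 \<le> v"
  shows "sigma_finite_subalgebra (P d v) (F n)"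
proof -
  interpret P: prob_space "P d v" using assms by (rule prob_space_P)
  interpret finite_measure_subalgebra "P d v" "F n"
    by unfold_locales (rule subalgebra_F[OF assms])
  show ?thesis by (rule sigma_finite_subalgebra_axioms)
qed

text \<open>The event \<tau> \<ge> \<open>v\<close> belongs to the conditioning sigma-algebra of
  Lorden's criterion, so Pollak's conditional mean is an average of that conditional expectation
  over the event.\<close>

lemma pollak_le_lorden:
  assumes "stop \<tau>"
  shows "pollak_delay P d \<tau> \<le> lorden_delay \<mu> X P d \<tau>"
  unfolding pollak_delay_def
proof (rule SUP_least)
  fix v assume "v \<in> {v. 1 \<le> v \<and> 0 < emeasure (P d v) {\<omega> \<in> space (P d v). enat v \<le> \<tau> \<omega>}}"
  then have v: "1 \<le> v" and pos: "0 < emeasure (P d v) {\<omega> \<in> space (P d v). enat v \<le> \<tau> \<omega>}"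
    by auto
  interpret P: prob_space "P d v" using v by (rule prob_space_P)
  interpret S: sigma_finite_subalgebra "P d v" "F (v - 1)" by (rule sigma_finite_subalgebra_F[OF v])
  define B where "B = {\<omega> \<in> space (P d v). enat v \<le> \<tau> \<omega>}"
  have B: "B \<in> sets (F (v - 1))" unfolding B_def space_P[OF v] by (rule stop_ge_sets[OF assms v])
  then have [measurable]: "B \<in> sets (P d v)" by (rule sets_F_P[OF v])
  note [measurable] = stop_measurable_P[OF assms v]
  define g where "g = nn_cond_exp (P d v) (F (v - 1)) (\<lambda>\<omega>. ennreal_of_enat (\<tau> \<omega> - enat v))"
  define e where "e = esssup (P d v) g"
  have "(\<integral>\<^sup>+\<omega>. ennreal_of_enat (\<tau> \<omega> - enat v) * indicator B \<omega> \<partial>P d v) =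
    (\<integral>\<^sup>+\<omega>. indicator B \<omega> * ennreal_of_enat (\<tau> \<omega> - enat v) \<partial>P d v)"
    by (simp add: mult.commute)
  also have "\<dots> = (\<integral>\<^sup>+\<omega>. indicator B \<omega> * g \<omega> \<partial>P d v)"
    unfolding g_def using B by (intro S.nn_cond_exp_intg[symmetric]) auto
  also have "\<dots> \<le> (\<integral>\<^sup>+\<omega>. e * indicator B \<omega> \<partial>P d v)"
    using esssup_AE[of g "P d v"] unfolding e_def
    by (intro nn_integral_mono_AE) (auto simp: indicator_def)
  also have "\<dots> = e * emeasure (P d v) B"
    by (simp add: nn_integral_cmult)
  finally have "(\<integral>\<^sup>+\<omega>. ennreal_of_enat (\<tau> \<omega> - enat v) \<partial>uniform_measure (P d v) B) \<le>
      e * emeasure (P d v) B / emeasure (P d v) B"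
    by (subst nn_integral_uniform_measure) (auto intro: divide_right_mono_ennreal)
  also have "\<dots> = e"
    using pos by (intro ennreal_mult_divide_eq) (auto simp: B_def P.emeasure_eq_measure)
  also have "\<dots> \<le> lorden_delay \<mu> X P d \<tau>"
    unfolding lorden_delay_def e_def g_def using v
    by (intro SUP_upper2[of v]) (auto simp: F_def space_P[OF v])
  finally show "(\<integral>\<^sup>+\<omega>. ennreal_of_enat (\<tau> \<omega> - enat v) \<partial>uniform_measure (P d v) {\<omega> \<in> space (P d v). enat v \<le> \<tau> \<omega>})
    \<le> lorden_delay \<mu> X P d \<tau>" by (simp add: B_def)
qed

subsection \<open>Upper bound on the delay\<close>

lemma measure_Diff_block_le:
  assumes A: "A \<in> sets (F N)" and v: "1 \<le> v" and s: "N < s"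
    and q: "1 - q \<le> measure (P d v) (block_gt d v s n a)"
  shows "measure (P d v) (A - block_gt d v s n a) \<le> measure (P d v) A * q"
proof -
  interpret P: prob_space "P d v" using v by (rule prob_space_P)
  have G: "block_gt d v s n a \<in> sets (P d v)"
    using s by (intro sets_F_P[OF v block_gt_sets_F[where N="s + n"]]) auto
  have A': "A \<in> sets (P d v)" using A v by (rule sets_F_P[rotated])
  have "measure (P d v) (A - block_gt d v s n a) =
    measure (P d v) A - measure (P d v) (A \<inter> block_gt d v s n a)"
    using A' G by (rule P.finite_measure_Diff')
  also have "\<dots> = measure (P d v) A * (1 - measure (P d v) (block_gt d v s n a))"
    unfolding indep_block_gt[OF A v s] by (simp add: algebra_simps)
  also have "\<dots> \<le> measure (P d v) A * q"
    using q by (intro mult_left_mono) auto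
  finally show ?thesis .
qed

text \<open>\<open>G i\<close> is the event that the first \<open>i\<close> blocks all fail. Block
  \<open>i + 1\<close> is looked at only on \<open>G (Suc i)\<close>, which has probability at most
  \<open>q ^ Suc i\<close> relative to any past event; summing gives the geometric term
  \<open>q / (1 - q)\<close>. Having the estimate on every event of \<open>F (v - 1)\<close> is what
  bounds the essential supremum.\<close>

lemma lorden_delay_le:
  assumes st: "stop \<tau>" and q: "0 \<le> q" "q < 1" and n: "1 \<le> n1" "1 \<le> n2"
    and cross: "\<And>v s n \<omega>. 1 \<le> v \<Longrightarrow> v \<le> s \<Longrightarrow> n \<in> {n1, n2} \<Longrightarrow>
      \<omega> \<in> block_gt d v s n a \<Longrightarrow> \<tau> \<omega> < enat (s + n)"
    and first: "\<And>v. 1 \<le> v \<Longrightarrow> 1 - q \<le> measure (P d v) (block_gt d v v n1 a)"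
    and later: "\<And>v s. 1 \<le> v \<Longrightarrow> v \<le> s \<Longrightarrow> 1 - q \<le> measure (P d v) (block_gt d v s n2 a)"
  shows "lorden_delay \<mu> X P d \<tau> \<le> ennreal (n1 + n2 * (q / (1 - q)))"
  unfolding lorden_delay_def
proof (rule SUP_least)
  fix v :: nat assume "v \<in> {1..}"
  then have v: "1 \<le> v" by simp
  interpret P: prob_space "P d v" using v by (rule prob_space_P)
  interpret S: sigma_finite_subalgebra "P d v" "F (v - 1)" by (rule sigma_finite_subalgebra_F[OF v])
  note [measurable] = stop_measurable_P[OF st v]
  \<comment> \<open>Block \<open>i\<close> starts at \<open>s i\<close> and has length
    \<open>len i\<close>; the blocks are adjacent, the first of length \<open>n1\<close> and all
    others of length \<open>n2\<close>.\<close>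
  define s where "s i = (if i = 0 then v else v + n1 + (i - 1) * n2)" for i :: nat
  define len where "len i = (if i = 0 then n1 else n2)" for i :: nat
  define E where "E i = block_gt d v (s i) (len i) a" for i
  define G where "G i = space Pinf - (\<Union>k<i. E k)" for i
  have s_Suc: "s (Suc i) = s i + len i" for i
    by (cases i) (auto simp: s_def len_def)
  have s_ge: "v \<le> s i" for i by (simp add: s_def)
  have s_mono: "s i \<le> s j" if "i \<le> j" for i j
    using that by (rule lift_Suc_mono_le[rotated]) (simp add: s_Suc)
  have len: "len i \<in> {n1, n2}" for i by (simp add: len_def)
  \<comment> \<open>Block \<open>k\<close> ends at index \<open>s (Suc k) - 1\<close>, so each
    earlier block is known just before block \<open>i\<close> begins.\<close>
  have E_F: "E k \<in> sets (F (s i - 1))" if "k < i" for k i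
    unfolding E_def using s_mono[of "Suc k" i] s_ge[of k] v that
    by (intro block_gt_sets_F) (auto simp: s_Suc)
  have G_F: "G i \<in> sets (F (s i - 1))" for i
    unfolding G_def using E_F[of _ i] sets.compl_sets[of "\<Union>k<i. E k" "F (s i - 1)"] by auto
  have G_sets[measurable]: "G i \<in> sets (P d v)" for i
    using G_F v by (rule sets_F_P[rotated])
  have E_prob: "1 - q \<le> measure (P d v) (E i)" for i
  proof (cases i)
    case 0
    then show ?thesis unfolding E_def using first[OF v] by (simp add: s_def len_def)
  next
    case (Suc k)
    then show ?thesis unfolding E_def using later[OF v s_ge[of i]] by (simp add: len_def)
  qed
  have AG: "measure (P d v) (A \<inter> G i) \<le> measure (P d v) A * q ^ i" if A: "A \<in> sets (F (v - 1))" for A i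
  proof (induction i)
    case 0
    have "A \<inter> G 0 = A" using sets.sets_into_space[OF A] by (auto simp: G_def)
    then show ?case by simp
  next
    case (Suc i)
    have "A \<in> sets (F (s i - 1))"
      using A sets_F_mono[of "v - 1" "s i - 1"] s_ge[of i] by (simp add: subset_iff)
    then have AGi: "A \<inter> G i \<in> sets (F (s i - 1))"
      using G_F[of i] by (rule sets.Int)
    have "A \<inter> G (Suc i) = A \<inter> G i - E i"
      by (auto simp: G_def lessThan_Suc)
    also have "measure (P d v) \<dots> \<le> measure (P d v) (A \<inter> G i) * q"
      unfolding E_def using AGi v s_ge[of i] E_prob[of i]
      by (intro measure_Diff_block_le) (auto simp: E_def)
    also have "\<dots> \<le> measure (P d v) A * q ^ i * q"
      using Suc q by (intro mult_right_mono) auto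
    finally show ?case by (simp add: algebra_simps)
  qed
  \<comment> \<open>If block \<open>i\<close> is the first to succeed, the delay is at most
    \<open>n1 + i * n2\<close>, and exactly the events \<open>G 1\<close> to \<open>G i\<close> have
    occurred, each contributing one \<open>n2\<close> to the sum.\<close>
  have point: "ennreal_of_enat (\<tau> \<omega> - enat v) \<le> of_nat n1 + (\<Sum>i. of_nat n2 * indicator (G (Suc i)) \<omega>)"
    if \<omega>: "\<omega> \<in> space Pinf" for \<omega>
  proof (cases "\<exists>i. \<omega> \<in> E i")
    case True
    define i where "i = (LEAST i. \<omega> \<in> E i)"
    have i: "\<omega> \<in> E i" unfolding i_def using True by (rule LeastI_ex)
    have less: "\<omega> \<notin> E k" if "k < i" for k using not_less_Least that unfolding i_def by blast
    have "\<tau> \<omega> < enat (s (Suc i))"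
      using cross[OF v s_ge len, of \<omega> i i] i unfolding E_def s_Suc by simp
    then have "\<tau> \<omega> - enat v \<le> enat (n1 + i * n2)"
      by (cases "\<tau> \<omega>") (auto simp: s_def)
    then have "ennreal_of_enat (\<tau> \<omega> - enat v) \<le> ennreal_of_enat (enat (n1 + i * n2))"
      by (simp only: ennreal_of_enat_le_iff)
    also have "\<dots> = of_nat n1 + of_nat i * of_nat n2"
      by simp
    also have "of_nat i * of_nat n2 = (\<Sum>k<i. of_nat n2 * indicator (G (Suc k)) \<omega> :: ennreal)"
    proof -
      have "\<omega> \<in> G (Suc k)" if "k < i" for k
        using less \<omega> that by (auto simp: G_def)
      then show ?thesis by simp
    qed
    also have "of_nat n1 + \<dots> \<le> of_nat n1 + (\<Sum>i. of_nat n2 * indicator (G (Suc i)) \<omega>)"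
      by (intro add_left_mono sum_le_suminf) auto
    finally show ?thesis .
  next
    case False
    then have "(\<lambda>i. of_nat n2 * indicator (G (Suc i)) \<omega>) = (\<lambda>_. of_nat n2 :: ennreal)"
      using \<omega> by (auto simp: G_def)
    \<comment> \<open>When no block succeeds, \<tau> may be infinite and the bound has to be
      infinite too; this uses \<open>1 \<le> n2\<close>.\<close>
    moreover have "(\<Sum>i::nat. of_nat n2 :: ennreal) = \<top>"
    proof (rule ccontr)
      assume "(\<Sum>i::nat. of_nat n2 :: ennreal) \<noteq> \<top>"
      then obtain N where N: "(\<Sum>i::nat. of_nat n2 :: ennreal) < of_nat N"
        using ennreal_Ex_less_of_nat by (auto simp: less_top)
      have "of_nat N \<le> (of_nat (N * n2) :: ennreal)"
        using n by (intro of_nat_mono) simp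
      also have "\<dots> = (\<Sum>i<N. of_nat n2)" by simp
      also have "\<dots> \<le> (\<Sum>i::nat. of_nat n2)" by (rule sum_le_suminf) auto
      finally show False using N by simp
    qed
    ultimately show ?thesis by simp
  qed
  define c where "c = ennreal (n1 + n2 * (q / (1 - q)))"
  have "AE \<omega> in P d v. nn_cond_exp (P d v) (F (v - 1)) (\<lambda>\<omega>. ennreal_of_enat (\<tau> \<omega> - enat v)) \<omega> \<le> c"
  proof (rule S.nn_cond_exp_le_const)
    fix A assume A: "A \<in> sets (F (v - 1))"
    have [measurable]: "A \<in> sets (P d v)" using A v by (rule sets_F_P[rotated])
    have geo: "(\<lambda>i. n2 * q * q ^ i) sums (n2 * q * (1 / (1 - q)))"
      using q by (intro sums_mult geometric_sums) auto
    have "(\<integral>\<^sup>+\<omega>. ennreal_of_enat (\<tau> \<omega> - enat v) * indicator A \<omega> \<partial>P d v) \<le>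
      (\<integral>\<^sup>+\<omega>. of_nat n1 * indicator A \<omega> + (\<Sum>i. of_nat n2 * indicator (A \<inter> G (Suc i)) \<omega>) \<partial>P d v)"
    proof (rule nn_integral_mono)
      fix \<omega> assume "\<omega> \<in> space (P d v)"
      then show "ennreal_of_enat (\<tau> \<omega> - enat v) * indicator A \<omega> \<le>
        of_nat n1 * indicator A \<omega> + (\<Sum>i. of_nat n2 * indicator (A \<inter> G (Suc i)) \<omega>)"
        using point[of \<omega>] by (cases "\<omega> \<in> A") (auto simp: space_P[OF v] indicator_inter_arith)
    qed
    also have "\<dots> = of_nat n1 * emeasure (P d v) A + (\<Sum>i. of_nat n2 * emeasure (P d v) (A \<inter> G (Suc i)))"
      by (subst nn_integral_add) (auto simp: nn_integral_cmult nn_integral_suminf)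
    also have "\<dots> \<le> of_nat n1 * emeasure (P d v) A + (\<Sum>i. ennreal (n2 * q * q ^ i) * emeasure (P d v) A)"
    proof (intro add_left_mono suminf_le)
      fix i
      have "of_nat n2 * emeasure (P d v) (A \<inter> G (Suc i)) = ennreal (n2 * measure (P d v) (A \<inter> G (Suc i)))"
        by (simp add: P.emeasure_eq_measure ennreal_mult ennreal_of_nat_eq_real_of_nat)
      also have "\<dots> \<le> ennreal (n2 * (measure (P d v) A * q ^ Suc i))"
        by (intro ennreal_leI mult_left_mono AG A) auto
      also have "\<dots> = ennreal (n2 * q * q ^ i) * emeasure (P d v) A"
        using q by (simp add: P.emeasure_eq_measure ennreal_mult[symmetric] algebra_simps)
      finally show "of_nat n2 * emeasure (P d v) (A \<inter> G (Suc i)) \<le> ennreal (n2 * q * q ^ i) * emeasure (P d v) A" .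
    qed auto
    also have "(\<Sum>i. ennreal (n2 * q * q ^ i) * emeasure (P d v) A) = (\<Sum>i. ennreal (n2 * q * q ^ i)) * emeasure (P d v) A"
      by simp
    also have "(\<Sum>i. ennreal (n2 * q * q ^ i)) = ennreal (n2 * q * (1 / (1 - q)))"
      using q by (intro suminf_ennreal_eq geo) auto
    also have "of_nat n1 * emeasure (P d v) A + ennreal (n2 * q * (1 / (1 - q))) * emeasure (P d v) A = c * emeasure (P d v) A"
      using q by (simp add: c_def ennreal_plus[symmetric] ennreal_of_nat_eq_real_of_nat distrib_right[symmetric] del: ennreal_plus)
    finally show "(\<integral>\<^sup>+\<omega>. ennreal_of_enat (\<tau> \<omega> - enat v) * indicator A \<omega> \<partial>P d v) \<le> c * emeasure (P d v) A" .
  qed (auto simp: c_def P.emeasure_space_1)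
  then have "esssup (P d v) (nn_cond_exp (P d v) (F (v - 1)) (\<lambda>\<omega>. ennreal_of_enat (\<tau> \<omega> - enat v))) \<le> c"
    by (intro esssup_I) auto
  then show "esssup (P d v) (nn_cond_exp (P d v) (obs_filtration (space (P d v)) \<mu> X (enat (v - 1)))
      (\<lambda>\<omega>. ennreal_of_enat (\<tau> \<omega> - enat v))) \<le> ennreal (n1 + n2 * (q / (1 - q)))"
    by (simp add: F_def space_P[OF v] c_def)
qed

section \<open>The two rules stop once a block exceeds its level\<close>

text \<open>\<open>w\<close> is the end \<open>v + d\<close> of the transient, clamped to the block.
  It supplies the candidate for \<open>v2\<close> in the statistics, at which they contain the true
  likelihood ratio of the block; blocks entirely inside or after the transient give the extreme
  values of \<open>w\<close>.\<close>

lemma block_split: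
  fixes s n d v :: nat
  assumes "1 \<le> n"
  defines "w \<equiv> max s (min (v + d) (s + n))"
  shows "s \<le> w" "w \<le> s + n"
    "(\<Prod>j\<in>{s..<s+n}. lr d v j (X j \<omega>)) =
      (\<Prod>j\<in>{s..<w}. f1 (X j \<omega>) / f0 (X j \<omega>)) * (\<Prod>j\<in>{w..s+n-1}. f2 (X j \<omega>) / f0 (X j \<omega>))"
proof -
  show w: "s \<le> w" "w \<le> s + n" by (auto simp: w_def)
  have "(\<Prod>j\<in>{s..<s+n}. lr d v j (X j \<omega>)) = (\<Prod>j\<in>{s..<w}. lr d v j (X j \<omega>)) * (\<Prod>j\<in>{w..<s+n}. lr d v j (X j \<omega>))"
    using w by (simp add: prod.atLeastLessThan_concat)
  also have "(\<Prod>j\<in>{s..<w}. lr d v j (X j \<omega>)) = (\<Prod>j\<in>{s..<w}. f1 (X j \<omega>) / f0 (X j \<omega>))"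
    by (intro prod.cong) (auto simp: w_def lr_def post_density_def)
  also have "(\<Prod>j\<in>{w..<s+n}. lr d v j (X j \<omega>)) = (\<Prod>j\<in>{w..s+n-1}. f2 (X j \<omega>) / f0 (X j \<omega>))"
    using assms by (intro prod.cong) (auto simp: w_def lr_def post_density_def)
  finally show "(\<Prod>j\<in>{s..<s+n}. lr d v j (X j \<omega>)) =
      (\<Prod>j\<in>{s..<w}. f1 (X j \<omega>) / f0 (X j \<omega>)) * (\<Prod>j\<in>{w..s+n-1}. f2 (X j \<omega>) / f0 (X j \<omega>))" .
qed

text \<open>At time \<open>s + n - 1\<close> the pair of \<open>s\<close> and the clamped end of the
  transient is among the candidates of the maximum.\<close>

lemma dcusum_less:
  assumes "1 \<le> s" "1 \<le> n" and \<omega>: "\<omega> \<in> block_gt d v s n b"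
  shows "dcusum f0 f1 f2 X b \<omega> < enat (s + n)"
proof -
  define w where "w = max s (min (v + d) (s + n))"
  define k where "k = s + n - 1"
  note w = block_split[OF assms(2), where s=s and v=v and d=d, folded w_def]
  let ?g = "\<lambda>v1 v2. elog ((\<Prod>j\<in>{v1..<v2}. f1 (X j \<omega>) / f0 (X j \<omega>)) * (\<Prod>j\<in>{v2..k}. f2 (X j \<omega>) / f0 (X j \<omega>)))"
  have "s \<in> {1..k}" "w \<in> {s..k + 1}" using w assms by (auto simp: k_def)
  have "ereal b < ?g s w"
    using \<omega> unfolding elog_less_iff block_gt_def w(3) k_def by simp
  also have "\<dots> \<le> Max (?g s ` {s..k + 1})"
    using \<open>w \<in> {s..k + 1}\<close> by (intro Max_ge imageI) auto
  also have "\<dots> \<le> dcusum_stat f0 f1 f2 X k \<omega>"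
    unfolding dcusum_stat_def using \<open>s \<in> {1..k}\<close> by (intro Max_ge image_eqI[of _ _ s]) auto
  finally have "ereal b < dcusum_stat f0 f1 f2 X k \<omega>" .
  then have "dcusum f0 f1 f2 X b \<omega> \<le> enat k"
    unfolding dcusum_def using assms by (intro Inf_lower) (auto simp: k_def)
  also have "enat k < enat (s + n)" using assms by (simp add: k_def)
  finally show ?thesis .
qed

lemma finite_wd_pairs: "finite {(v1, v2). 1 \<le> v1 \<and> v1 \<le> v2 \<and> v2 \<le> k + (1::nat)}"
  by (rule finite_subset[of _ "{..k+1} \<times> {..k+1}"]) auto

lemma le_wdcusum_stat_iff:
  "ereal b \<le> wdcusum_stat f0 f1 f2 X \<rho> k \<omega> \<longleftrightarrow>
    (\<exists>v1\<in>{1..k+1}. \<exists>v2\<in>{v1..k+1}. exp b \<le> \<rho> ^ (if v2 \<le> k then 1 else 0) *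
            (\<Prod>j\<in>{v1..<v2}. (1 - \<rho>) * f1 (X j \<omega>) / f0 (X j \<omega>)) *
            (\<Prod>j\<in>{v2..k}. f2 (X j \<omega>) / f0 (X j \<omega>)))"
proof -
  have ne: "{(v1, v2). 1 \<le> v1 \<and> v1 \<le> v2 \<and> v2 \<le> k + (1::nat)} \<noteq> {}"
    by (auto intro!: exI[of _ "k + 1"])
  show ?thesis
    unfolding wdcusum_stat_def using ne
    by (subst Max_ge_iff) (auto simp: finite_wd_pairs elog_ge_iff Bex_def)
qed

text \<open>The weights cost at most a factor \<open>\<rho> * (1 - \<rho>) ^ n\<close> over a block
  of length \<open>n\<close>; the level \<open>a\<close> is the threshold raised by minus its
  logarithm.\<close>

lemma wdcusum_less:
  assumes "1 \<le> s" "1 \<le> n" and \<rho>: "0 < \<rho>" "\<rho> < 1"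
    and a: "b - ln \<rho> - n * ln (1 - \<rho>) \<le> a"
    and \<omega>: "\<omega> \<in> block_gt d v s n a"
  shows "wdcusum f0 f1 f2 X \<rho> b \<omega> < enat (s + n)"
proof -
  define w where "w = max s (min (v + d) (s + n))"
  define k where "k = s + n - 1"
  note w = block_split[OF assms(2), where s=s and v=v and d=d, folded w_def]
  have \<omega>': "\<omega> \<in> space Pinf" using \<omega> by (simp add: block_gt_def)
  let ?L = "\<Prod>j\<in>{s..<s+n}. lr d v j (X j \<omega>)"
  have L0: "0 \<le> ?L" using assms(1) \<omega>' by (intro prod_nonneg) (auto intro!: lr_nonneg X_space)
  have "exp b = \<rho> * (1 - \<rho>) ^ n * exp (b - ln \<rho> - n * ln (1 - \<rho>))"
    using \<rho> by (simp add: exp_diff exp_of_nat_mult)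
  also have "\<dots> \<le> \<rho> * (1 - \<rho>) ^ n * exp a"
    using a \<rho> by (intro mult_left_mono) auto
  also have "\<dots> \<le> \<rho> * (1 - \<rho>) ^ n * ?L"
    using \<omega> \<rho> by (intro mult_left_mono) (auto simp: block_gt_def)
  \<comment> \<open>The statistic pays \<rho> only if the block reaches the second phase, and
    \<open>1 - \<rho>\<close> only for its \<open>w - s\<close> transient observations; both
    exponents are at most those of the worst case.\<close>
  also have "\<dots> \<le> \<rho> ^ (if w \<le> k then 1 else 0) * (1 - \<rho>) ^ (w - s) * ?L"
    using \<rho> w by (intro mult_right_mono[OF mult_mono] L0) (auto intro: power_decreasing)
  also have "\<dots> = \<rho> ^ (if w \<le> k then 1 else 0) *
            (\<Prod>j\<in>{s..<w}. (1 - \<rho>) * f1 (X j \<omega>) / f0 (X j \<omega>)) *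
            (\<Prod>j\<in>{w..k}. f2 (X j \<omega>) / f0 (X j \<omega>))"
    unfolding w(3) k_def by (simp add: prod.distrib prod_dividef)
  finally have "ereal b \<le> wdcusum_stat f0 f1 f2 X \<rho> k \<omega>"
    unfolding le_wdcusum_stat_iff using w(1,2) assms by (intro bexI[of _ s] bexI[of _ w]) (auto simp: k_def)
  then have "wdcusum f0 f1 f2 X \<rho> b \<omega> \<le> enat k"
    unfolding wdcusum_def using assms by (intro Inf_lower) (auto simp: k_def)
  also have "enat k < enat (s + n)" using assms by (simp add: k_def)
  finally show ?thesis .
qed

lemma filtration_obs: "filtration (space Pinf) (obs_filtration (space Pinf) \<mu> X)"
proof
  show "space (obs_filtration (space Pinf) \<mu> X t) = space Pinf" for t
    unfolding obs_filtration_def by (simp add: space_measure_of_conv)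
  show "sets (obs_filtration (space Pinf) \<mu> X i) \<subseteq> sets (obs_filtration (space Pinf) \<mu> X j)" if "i \<le> j" for i j
    unfolding sets_obs using order.trans[OF _ that] by (intro sigma_sets_mono') blast
qed

text \<open>For this rule only the mean time to false alarm is assumed, so membership in
  \<open>C_class\<close> has to be completed here. For D-CuSum membership itself is assumed.\<close>

lemma stop_wdcusum: "stop (wdcusum f0 f1 f2 X \<rho> b)"
proof -
  define Q where "Q t \<omega> \<longleftrightarrow> (\<exists>k. t = enat k \<and> 1 \<le> k \<and> ereal b \<le> wdcusum_stat f0 f1 f2 X \<rho> k \<omega>)" for t \<omega>
  have "stop (\<lambda>\<omega>. Inf {t. Q t \<omega>})"
  proof (rule stopping_time_Inf_enat[OF filtration_obs])
    fix t
    show "Measurable.pred (obs_filtration (space Pinf) \<mu> X t) (Q t)"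
    proof (cases t)
      case (enat k)
      note [measurable] = density_measurable
      have [measurable]: "(\<lambda>\<omega>. (1 - \<rho>) * f1 (X j \<omega>) / f0 (X j \<omega>)) \<in> borel_measurable (F k)"
          "(\<lambda>\<omega>. f2 (X j \<omega>) / f0 (X j \<omega>)) \<in> borel_measurable (F k)" if "1 \<le> j" "j \<le> k" for j
        using that by measurable
      have "Measurable.pred (F k) (\<lambda>\<omega>. exp b \<le> \<rho> ^ (if v2 \<le> k then 1 else 0) *
            (\<Prod>j\<in>{v1..<v2}. (1 - \<rho>) * f1 (X j \<omega>) / f0 (X j \<omega>)) *
            (\<Prod>j\<in>{v2..k}. f2 (X j \<omega>) / f0 (X j \<omega>)))"
        if "v1 \<in> {1..k+1}" "v2 \<in> {v1..k+1}" for v1 v2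
        unfolding pred_def using that
        by (intro borel_measurable_le borel_measurable_times borel_measurable_prod) auto
      then have "Measurable.pred (F k) (\<lambda>\<omega>. ereal b \<le> wdcusum_stat f0 f1 f2 X \<rho> k \<omega>)"
        unfolding le_wdcusum_stat_iff by (intro pred_intros_finite) auto
      then have "Measurable.pred (F k) (Q t)"
        unfolding Q_def enat by simp
      then show ?thesis by (simp add: F_def enat)
    qed (simp add: Q_def[abs_def])
  qed
  moreover have "wdcusum f0 f1 f2 X \<rho> b = (\<lambda>\<omega>. Inf {t. Q t \<omega>})"
    by (auto simp: wdcusum_def Q_def fun_eq_iff intro!: arg_cong[where f=Inf])
  ultimately show ?thesis by simp
qed

section \<open>From products of likelihood ratios to sums of logarithms\<close>

text \<open>A large sum of logarithms yields a large product only if no factor is 0, which holds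
  almost surely; hence an inequality of probabilities and not an inclusion.\<close>

lemma block_gt_compl_le:
  assumes v: "1 \<le> v" "v \<le> s"
  shows "1 - measure (P d v) {\<omega> \<in> space Pinf. (\<Sum>j\<in>{s..<s+n}. ln (lr d v j (X j \<omega>))) \<le> a}
    \<le> measure (P d v) (block_gt d v s n a)"
proof -
  interpret P: prob_space "P d v" using v(1) by (rule prob_space_P)
  let ?D = "{\<omega> \<in> space Pinf. (\<Sum>j\<in>{s..<s+n}. ln (lr d v j (X j \<omega>))) \<le> a}"
  have m: "(\<lambda>\<omega>. ln (lr d v j (X j \<omega>))) \<in> borel_measurable (P d v)" if "j \<in> {s..<s+n}" for j
    using that v by (intro borel_measurable_ln measurable_compose[OF _ lr_measurable] X_measurable_P) auto
  have "{\<omega> \<in> space (P d v). (\<Sum>j\<in>{s..<s+n}. ln (lr d v j (X j \<omega>))) \<le> a} \<in> sets (P d v)"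
    using m by (intro borel_measurable_le borel_measurable_sum) auto
  then have D: "?D \<in> sets (P d v)" by (simp add: space_P[OF v(1)])
  have "1 - measure (P d v) ?D = measure (P d v) (space (P d v) - ?D)"
    using D by (simp add: P.prob_compl)
  also have "\<dots> \<le> measure (P d v) (block_gt d v s n a)"
  proof (rule P.finite_measure_mono_AE)
    have "AE \<omega> in P d v. \<forall>j\<in>{s..<s+n}. 0 < lr d v j (X j \<omega>)"
      using v by (intro AE_finite_allI lr_pos_AE) auto
    then show "AE \<omega> in P d v. \<omega> \<in> space (P d v) - ?D \<longrightarrow> \<omega> \<in> block_gt d v s n a"
    proof eventually_elim
      case (elim \<omega>)
      then have "exp (\<Sum>j\<in>{s..<s+n}. ln (lr d v j (X j \<omega>))) = (\<Prod>j\<in>{s..<s+n}. lr d v j (X j \<omega>))"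
        by (simp add: exp_sum)
      then show ?case
        by (auto simp: block_gt_def space_P[OF v(1)] not_le) (metis exp_less_mono)
    qed
    show "block_gt d v s n a \<in> sets (P d v)"
      using v by (intro sets_F_P[OF v(1) block_gt_sets_F[where N="s + n"]]) auto
  qed
  finally show ?thesis .
qed

text \<open>This direction is pointwise, because a product above \<open>exp a\<close> has no zero
  factor.\<close>

lemma block_gt_subset:
  assumes v: "1 \<le> v" "v \<le> s"
  shows "block_gt d v s n a \<subseteq> {\<omega> \<in> space Pinf. a < (\<Sum>j\<in>{s..<s+n}. ln (lr d v j (X j \<omega>)))}"
proof
  fix \<omega> assume "\<omega> \<in> block_gt d v s n a"
  then have \<omega>: "\<omega> \<in> space Pinf" and gt: "exp a < (\<Prod>j\<in>{s..<s+n}. lr d v j (X j \<omega>))"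
    by (auto simp: block_gt_def)
  have pos: "0 < lr d v j (X j \<omega>)" if j: "j \<in> {s..<s+n}" for j
  proof -
    have "lr d v j (X j \<omega>) \<noteq> 0"
      using gt j by (metis exp_gt_zero finite_atLeastLessThan less_asym prod_zero_iff)
    moreover have "0 \<le> lr d v j (X j \<omega>)"
      using v j \<omega> by (intro lr_nonneg X_space) auto
    ultimately show ?thesis by simp
  qed
  have "ln (exp a) < ln (\<Prod>j\<in>{s..<s+n}. lr d v j (X j \<omega>))"
    using gt by (subst ln_less_cancel_iff) (auto intro: order.strict_trans[OF exp_gt_zero])
  also have "\<dots> = (\<Sum>j\<in>{s..<s+n}. ln (lr d v j (X j \<omega>)))"
    by (intro ln_prod) (use pos in fastforce)+
  finally show "\<omega> \<in> {\<omega> \<in> space Pinf. a < (\<Sum>j\<in>{s..<s+n}. ln (lr d v j (X j \<omega>)))}"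
    using \<omega> by simp
qed

subsection \<open>Asymptotics\<close>

abbreviation "I1 \<equiv> kl_number \<mu> f1 f0"
abbreviation "I2 \<equiv> kl_number \<mu> f2 f0"

lemma sum_kl_onset: "(\<Sum>j\<in>{v..<v+n}. kl d v j) = I2 * real n + (I1 - I2) * min (real n) (real d)"
proof -
  have "(\<Sum>j\<in>{v..<v+n}. kl d v j) = (\<Sum>j\<in>{v..<v + min n d}. kl d v j) + (\<Sum>j\<in>{v + min n d..<v+n}. kl d v j)"
    by (rule sum.atLeastLessThan_concat[symmetric]) auto
  also have "(\<Sum>j\<in>{v..<v + min n d}. kl d v j) = (\<Sum>j\<in>{v..<v + min n d}. I1)"
    by (intro sum.cong) (auto simp: kl_def)
  also have "(\<Sum>j\<in>{v + min n d..<v+n}. kl d v j) = (\<Sum>j\<in>{v + min n d..<v+n}. I2)"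
    by (intro sum.cong) (auto simp: kl_def)
  finally show ?thesis by (auto simp: min_def of_nat_diff algebra_simps)
qed

lemma sum_kl_ge: "min I1 I2 * real n \<le> (\<Sum>j\<in>{s..<s+n}. kl d v j)"
proof -
  have "(\<Sum>j\<in>{s..<s+n}. min I1 I2) \<le> (\<Sum>j\<in>{s..<s+n}. kl d v j)"
    by (intro sum_mono) (auto simp: kl_def)
  then show ?thesis by (simp add: mult.commute)
qed

lemma llr_deviation_uniform:
  assumes "0 < q" "0 < \<delta>" "0 < \<kappa>"
  obtains R where "0 < R"
    "\<And>x d v s n. R \<le> x \<Longrightarrow> 1 \<le> v \<Longrightarrow> v \<le> s \<Longrightarrow> real n \<le> \<kappa> * x \<Longrightarrow>
      measure (P d v) {\<omega> \<in> space Pinf. \<delta> * x \<le> \<bar>\<Sum>j\<in>{s..<s+n}. ln (lr d v j (X j \<omega>)) - kl d v j\<bar>} \<le> q"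
proof -
  \<comment> \<open>The numerator has the budget \<open>q * \<delta> * x\<close>: \<eta> spends half
    of it on blocks of the maximal length \<open>\<kappa> * x\<close>, and the requirement on
    \<open>x\<close> keeps \<open>C\<close> within the other half.\<close>
  define \<eta> where "\<eta> = q * \<delta> / (2 * \<kappa>)"
  have \<eta>: "0 < \<eta>" using assms by (simp add: \<eta>_def)
  obtain C where C: "0 < C" and dev: "\<And>d v s n t. 1 \<le> v \<Longrightarrow> v \<le> s \<Longrightarrow> 0 < t \<Longrightarrow>
      measure (P d v) {\<omega> \<in> space Pinf. t \<le> \<bar>\<Sum>j\<in>{s..<s+n}. ln (lr d v j (X j \<omega>)) - kl d v j\<bar>}
        \<le> (C + \<eta> * n) / t"
    using llr_deviation[OF \<eta>] by blast
  show thesis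
  proof (rule that[of "2 * C / (q * \<delta>)"])
    show pos: "0 < 2 * C / (q * \<delta>)" using C assms by simp
    fix x :: real and d v s n :: nat
    assume x: "2 * C / (q * \<delta>) \<le> x" and v: "1 \<le> v" "v \<le> s" and n: "real n \<le> \<kappa> * x"
    have x0: "0 < x" using pos x by simp
    have "\<eta> * n \<le> \<eta> * (\<kappa> * x)" using n \<eta> by (intro mult_left_mono) auto
    also have "\<dots> = q * \<delta> * x / 2" using assms by (simp add: \<eta>_def)
    finally have 1: "\<eta> * n \<le> q * \<delta> * x / 2" .
    have 2: "C \<le> q * \<delta> * x / 2" using x assms by (simp add: field_simps)
    have "measure (P d v) {\<omega> \<in> space Pinf. \<delta> * x \<le> \<bar>\<Sum>j\<in>{s..<s+n}. ln (lr d v j (X j \<omega>)) - kl d v j\<bar>}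
      \<le> (C + \<eta> * n) / (\<delta> * x)"
      using dev[OF v] assms x0 by simp
    also have "\<dots> \<le> (q * \<delta> * x) / (\<delta> * x)"
      using 1 2 assms x0 by (intro divide_right_mono) auto
    also have "\<dots> = q" using assms x0 by simp
    finally show "measure (P d v) {\<omega> \<in> space Pinf. \<delta> * x \<le> \<bar>\<Sum>j\<in>{s..<s+n}. ln (lr d v j (X j \<omega>)) - kl d v j\<bar>} \<le> q" .
  qed
qed

lemma llr_deviation_sets:
  assumes "1 \<le> v" "1 \<le> s"
  shows "{\<omega> \<in> space Pinf. t \<le> \<bar>\<Sum>j\<in>{s..<s+n}. ln (lr d v j (X j \<omega>)) - kl d v j\<bar>} \<in> sets (P d v)"
proof -
  have m: "(\<lambda>\<omega>. ln (lr d v j (X j \<omega>))) \<in> borel_measurable (P d v)" if "j \<in> {s..<s+n}" for j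
    using that assms by (intro borel_measurable_ln measurable_compose[OF _ lr_measurable] X_measurable_P) auto
  have "{\<omega> \<in> space (P d v). t \<le> \<bar>\<Sum>j\<in>{s..<s+n}. ln (lr d v j (X j \<omega>)) - kl d v j\<bar>} \<in> sets (P d v)"
    by (intro borel_measurable_le borel_measurable_abs borel_measurable_sum borel_measurable_diff m) auto
  then show ?thesis by (simp add: space_P[OF assms(1)])
qed

text \<open>If the mean exceeds the level by \<open>t\<close>, a sum of logarithms not above the
  level deviates by at least \<open>t\<close>.\<close>

lemma measure_block_gt_ge:
  assumes v: "1 \<le> v" "v \<le> s" and a: "a + t \<le> (\<Sum>j\<in>{s..<s+n}. kl d v j)"
    and dev: "measure (P d v) {\<omega> \<in> space Pinf. t \<le> \<bar>\<Sum>j\<in>{s..<s+n}. ln (lr d v j (X j \<omega>)) - kl d v j\<bar>} \<le> q"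
  shows "1 - q \<le> measure (P d v) (block_gt d v s n a)"
proof -
  interpret P: prob_space "P d v" using v(1) by (rule prob_space_P)
  have "measure (P d v) {\<omega> \<in> space Pinf. (\<Sum>j\<in>{s..<s+n}. ln (lr d v j (X j \<omega>))) \<le> a} \<le>
    measure (P d v) {\<omega> \<in> space Pinf. t \<le> \<bar>\<Sum>j\<in>{s..<s+n}. ln (lr d v j (X j \<omega>)) - kl d v j\<bar>}"
    using v a by (intro P.finite_measure_mono llr_deviation_sets) (auto simp: sum_subtractf)
  then show ?thesis using block_gt_compl_le[OF v, of d n a] dev by linarith
qed

lemma measure_block_gt_le:
  assumes v: "1 \<le> v" "v \<le> s" and a: "(\<Sum>j\<in>{s..<s+n}. kl d v j) + t \<le> a"
    and dev: "measure (P d v) {\<omega> \<in> space Pinf. t \<le> \<bar>\<Sum>j\<in>{s..<s+n}. ln (lr d v j (X j \<omega>)) - kl d v j\<bar>} \<le> q"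
  shows "measure (P d v) (block_gt d v s n a) \<le> q"
proof -
  interpret P: prob_space "P d v" using v(1) by (rule prob_space_P)
  have "measure (P d v) (block_gt d v s n a) \<le>
    measure (P d v) {\<omega> \<in> space Pinf. t \<le> \<bar>\<Sum>j\<in>{s..<s+n}. ln (lr d v j (X j \<omega>)) - kl d v j\<bar>}"
  proof (rule P.finite_measure_mono)
    show "block_gt d v s n a \<subseteq> {\<omega> \<in> space Pinf. t \<le> \<bar>\<Sum>j\<in>{s..<s+n}. ln (lr d v j (X j \<omega>)) - kl d v j\<bar>}"
      using block_gt_subset[OF v, of d n a] a by (auto simp: sum_subtractf subset_iff)
  qed (use v in \<open>auto intro: llr_deviation_sets\<close>)
  then show ?thesis using dev by simp
qed

definition delay_rate :: "ereal \<Rightarrow> real" where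
  "delay_rate c1 = (if c1 > 1 then 1 / I1 else real_of_ereal c1 / I1 + (1 - real_of_ereal c1) / I2)"

lemma opt_delay_eq: "opt_delay I1 I2 c1 \<gamma> = delay_rate c1 * ln \<gamma>"
  by (simp add: opt_delay_def delay_rate_def)

lemma delay_rate_pos:
  assumes "0 \<le> c1"
  shows "0 < delay_rate c1"
proof (cases "c1 > 1")
  case True
  then show ?thesis using kl_pos by (simp add: delay_rate_def)
next
  case False
  then obtain r where r: "c1 = ereal r" "0 \<le> r" "r \<le> 1"
    using assms by (cases c1) auto
  have "0 < r / I1 + (1 - r) / I2"
    using r kl_pos by (cases "r = 1") (auto intro: add_nonneg_pos)
  then show ?thesis using False r by (simp add: delay_rate_def)
qed

text \<open>\<open>delay_rate c1\<close> solves \<open>I2 y + (I1 - I2) min y (c1 / I1) = 1\<close>: it is the number of observations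
  after the change, in units of \<open>ln \<gamma>\<close>, whose mean log-likelihood ratio is \<open>ln \<gamma>\<close>.\<close>

lemma drift_at_delay_rate:
  fixes d :: "real \<Rightarrow> nat"
  assumes c1: "0 \<le> c1"
    and d: "((\<lambda>\<gamma>. ereal (real (d \<gamma>) * I1 / ln \<gamma>)) \<longlongrightarrow> c1) at_top"
  shows "((\<lambda>\<gamma>. I2 * delay_rate c1 + (I1 - I2) * min (delay_rate c1) (real (d \<gamma>) / ln \<gamma>)) \<longlongrightarrow> 1) at_top"
proof (cases "c1 > 1")
  \<comment> \<open>This includes \<open>c1 = \<infinity>\<close>: the transient eventually outlasts
    \<open>1 / I1\<close> units of \<open>ln \<gamma>\<close>, so the minimum is its first argument
    and the expression equals 1 exactly.\<close>
  case True
  have "\<forall>\<^sub>F \<gamma> in at_top. 1 < ereal (real (d \<gamma>) * I1 / ln \<gamma>)"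
    by (rule order_tendstoD(1)[OF d True])
  then have "\<forall>\<^sub>F \<gamma> in at_top. I2 * delay_rate c1 + (I1 - I2) * min (delay_rate c1) (real (d \<gamma>) / ln \<gamma>) = 1"
    using eventually_le_ln[of 1]
  proof eventually_elim
    case (elim \<gamma>)
    then have "1 / I1 \<le> real (d \<gamma>) / ln \<gamma>"
      using kl_pos by (simp add: one_ereal_def field_simps)
    then have "min (1 / I1) (real (d \<gamma>) / ln \<gamma>) = 1 / I1" by simp
    then show ?case using True kl_pos by (simp add: delay_rate_def field_simps)
  qed
  then show ?thesis by (rule tendsto_eventually)
next
  case False
  then obtain r where r: "c1 = ereal r" "0 \<le> r" "r \<le> 1"
    using c1 by (cases c1) auto
  have K: "delay_rate c1 = r / I1 + (1 - r) / I2"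
    using False r by (simp add: delay_rate_def)
  have "((\<lambda>\<gamma>. real (d \<gamma>) * I1 / ln \<gamma>) \<longlongrightarrow> r) at_top"
    using d unfolding r by simp
  from tendsto_divide[OF this tendsto_const[of I1]]
  have lim: "((\<lambda>\<gamma>. real (d \<gamma>) / ln \<gamma>) \<longlongrightarrow> r / I1) at_top"
    using kl_pos by (simp add: field_simps)
  have "((\<lambda>\<gamma>. I2 * delay_rate c1 + (I1 - I2) * min (delay_rate c1) (real (d \<gamma>) / ln \<gamma>)) \<longlongrightarrow>
      I2 * delay_rate c1 + (I1 - I2) * min (delay_rate c1) (r / I1)) at_top"
    by (intro tendsto_intros lim)
  also have "min (delay_rate c1) (r / I1) = r / I1"
    using r kl_pos unfolding K by (intro min_absorb2) simp
  also have "I2 * delay_rate c1 + (I1 - I2) * (r / I1) = 1"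
    using kl_pos by (simp add: K field_simps)
  finally show ?thesis .
qed

lemma pollak_lower_bound:
  fixes d :: "real \<Rightarrow> nat"
  assumes c1: "0 \<le> c1"
    and d: "((\<lambda>\<gamma>. ereal (real (d \<gamma>) * I1 / ln \<gamma>)) \<longlongrightarrow> c1) at_top"
    and \<epsilon>: "0 < \<epsilon>" "\<epsilon> < 1"
  shows "\<forall>\<^sub>F \<gamma> in at_top. \<forall>\<tau>\<in>C_class \<mu> X Pinf \<gamma>.
    ennreal ((1 - \<epsilon>) * (delay_rate c1 * ln \<gamma>)) \<le> pollak_delay P (d \<gamma>) \<tau>"
proof -
  define K where "K = delay_rate c1"
  define J where "J = min I1 I2"
  \<comment> \<open>One third is lost by shortening the window by the factor \<open>1 - e\<close>,
    one by rounding its length down, and one by the probability of an alarm inside it.\<close>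
  define e where "e = \<epsilon> / 3"
  \<comment> \<open>Shortening the window by \<open>e * K\<close> lowers the normalised mean by at
    least \<open>J * e * K = 4 * \<delta>\<close>. Of this, \<open>2 * \<delta>\<close> absorbs the
    error of the limiting drift, one \<delta> the random deviation, and one \<delta> keeps the level
    at \<open>(1 - \<delta>) * ln \<gamma>\<close>.\<close>
  define \<delta> where "\<delta> = J * e * K / 4"
  have K: "0 < K" unfolding K_def using c1 by (rule delay_rate_pos)
  have J: "0 < J" using kl_pos by (simp add: J_def)
  have e: "0 < e" "e < 1/3" using \<epsilon> by (auto simp: e_def)
  have \<delta>: "0 < \<delta>" using J e K by (simp add: \<delta>_def)
  obtain R where R: "0 < R" and dev: "\<And>x d v s n. R \<le> x \<Longrightarrow> 1 \<le> v \<Longrightarrow> v \<le> s \<Longrightarrow> real n \<le> K * x \<Longrightarrow>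
      measure (P d v) {\<omega> \<in> space Pinf. \<delta> * x \<le> \<bar>\<Sum>j\<in>{s..<s+n}. ln (lr d v j (X j \<omega>)) - kl d v j\<bar>} \<le> e / 2"
    using llr_deviation_uniform[of "e / 2" \<delta> K] e \<delta> K by auto
  have drift: "\<forall>\<^sub>F \<gamma> in at_top. I2 * K + (I1 - I2) * min K (real (d \<gamma>) / ln \<gamma>) < 1 + 2 * \<delta>"
    unfolding K_def using \<delta> by (intro order_tendstoD(2)[OF drift_at_delay_rate[OF c1 d]]) simp
  \<comment> \<open>At the level \<open>(1 - \<delta>) * ln \<gamma>\<close> the inflated hazard is
    linear in \<open>ln \<gamma>\<close> times a negative power of \<gamma>.\<close>
  have "((\<lambda>x. 2 * (K * x) * exp (- \<delta> * x)) \<longlongrightarrow> 0) at_top"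
    using \<delta> K by real_asymp
  then have "((\<lambda>\<gamma>. 2 * (K * ln \<gamma>) * exp (- \<delta> * ln \<gamma>)) \<longlongrightarrow> 0) at_top"
    by (rule filterlim_compose[OF _ ln_at_top])
  then have small: "\<forall>\<^sub>F \<gamma> in at_top. 2 * (K * ln \<gamma>) * exp (- \<delta> * ln \<gamma>) < e / 2"
    using e by (intro order_tendstoD(2)) auto
  show ?thesis
    using drift small eventually_le_ln[of R] eventually_le_ln[of "1 / (e * K)"] eventually_le_ln[of 1] eventually_le_ln[of "3 / K"] eventually_gt_at_top[of 0]
  proof eventually_elim
    case (elim \<gamma>)
    define x where "x = ln \<gamma>"
    have x: "R \<le> x" "1 \<le> e * K * x" "1 \<le> x" "3 \<le> K * x"
      using elim e K by (auto simp: x_def field_simps)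
    have \<gamma>: "0 < \<gamma>" by fact
    have \<gamma>x: "\<gamma> = exp x" using \<gamma> by (simp add: x_def)
    define m where "m = nat \<lfloor>(1 - e) * K * x\<rfloor>"
    have x0: "0 < x" using x(3) by simp
    have Kx0: "0 \<le> K * x" using x(4) by simp
    have pos: "0 \<le> (1 - e) * K * x" using e Kx0 by (simp add: mult.assoc)
    have m_le: "real m \<le> (1 - e) * K * x"
      unfolding m_def using pos by (simp add: of_nat_nat)
    have m_ge: "(1 - 2 * e) * K * x \<le> real m"
    proof -
      have "(1 - e) * K * x < real m + 1" unfolding m_def using pos by linarith
      then show ?thesis using x(2) by (simp add: algebra_simps)
    qed
    have "1 \<le> (1 - 2 * e) * (K * x)"
      using mult_mono[of "1/3" "1 - 2*e" 3 "K*x"] e x(4) by simp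
    then have m1: "1 \<le> m" using m_ge by (simp add: mult.assoc)
    have m_le': "real m \<le> K * x"
      using m_le e Kx0 mult_right_mono[of "1 - e" 1 "K * x"] by (simp add: mult.assoc)
    have drift_m: "(\<Sum>j\<in>{v..<v+m}. kl (d \<gamma>) v j) + \<delta> * x \<le> (1 - \<delta>) * x" for v
    proof -
      let ?c = "real (d \<gamma>) / x"
      have yK: "real m / x \<le> (1 - e) * K"
        using m_le x by (simp add: divide_le_eq)
      have yK': "real m / x \<le> K" using m_le' x by (simp add: divide_le_eq)
      have "J * (K - real m / x) \<le> (I2 * K + (I1 - I2) * min K ?c) - (I2 * (real m / x) + (I1 - I2) * min (real m / x) ?c)"
        unfolding J_def by (rule min_slope[OF yK'])
      moreover have "J * (e * K) \<le> J * (K - real m / x)"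
        using yK J by (intro mult_left_mono) (auto simp: algebra_simps)
      moreover have "J * (e * K) = 4 * \<delta>" by (simp add: \<delta>_def)
      ultimately have "I2 * (real m / x) + (I1 - I2) * min (real m / x) ?c \<le> 1 - 2 * \<delta>"
        using elim(1) unfolding x_def by linarith
      then have "x * (I2 * (real m / x) + (I1 - I2) * min (real m / x) ?c) \<le> x * (1 - 2 * \<delta>)"
        using x by (intro mult_left_mono) auto
      then show ?thesis
        unfolding sum_kl_onset min_scale[OF x0] by (simp add: algebra_simps)
    qed
    have \<beta>: "measure (P (d \<gamma>) v) (block_gt (d \<gamma>) v v m ((1 - \<delta>) * x)) \<le> e / 2" if "1 \<le> v" for v
      using that by (intro measure_block_gt_le[OF _ _ drift_m] dev x m_le') auto
    have "exp ((1 - \<delta>) * x) * (2 * real m / \<gamma>) = 2 * real m * exp (- \<delta> * x)"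
    proof -
      have "exp ((1 - \<delta>) * x) = \<gamma> * exp (- \<delta> * x)"
        unfolding \<gamma>x exp_add[symmetric] by (simp add: algebra_simps)
      then show ?thesis using \<gamma> by simp
    qed
    also have "\<dots> \<le> 2 * (K * x) * exp (- \<delta> * x)"
      using m_le' by (intro mult_right_mono) auto
    also have "\<dots> \<le> e / 2" using elim(2) by (simp add: x_def)
    finally have small: "exp ((1 - \<delta>) * x) * (2 * real m / \<gamma>) + e / 2 \<le> e" by simp
    show ?case
    proof
      fix \<tau> assume \<tau>: "\<tau> \<in> C_class \<mu> X Pinf \<gamma>"
      have "(1 - \<epsilon>) * (K * x) \<le> ((1 - 2 * e) * (1 - e)) * (K * x)"
      proof (rule mult_right_mono[OF _ Kx0])
        have "(1 - 2 * e) * (1 - e) = 1 - 3 * e + 2 * e * e" by (simp add: algebra_simps)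
        then show "1 - \<epsilon> \<le> (1 - 2 * e) * (1 - e)" using e by (simp add: e_def)
      qed
      also have "\<dots> = ((1 - 2 * e) * K * x) * (1 - e)" by simp
      also have "\<dots> \<le> real m * (1 - (exp ((1 - \<delta>) * x) * (2 * real m / \<gamma>) + e / 2))"
        using m_ge small e by (intro mult_mono) auto
      finally have "ennreal ((1 - \<epsilon>) * (K * x)) \<le>
        ennreal (real m * (1 - (exp ((1 - \<delta>) * x) * (2 * real m / \<gamma>) + e / 2)))"
        by (rule ennreal_leI)
      also have "\<dots> \<le> pollak_delay P (d \<gamma>) \<tau>"
        by (rule pollak_delay_ge[OF \<tau> \<gamma> m1 \<beta>])
      finally show "ennreal ((1 - \<epsilon>) * (delay_rate c1 * ln \<gamma>)) \<le> pollak_delay P (d \<gamma>) \<tau>"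
        by (simp add: K_def x_def)
    qed
  qed
qed

text \<open>The level \<open>a\<close> may depend on the bound \<kappa> for block lengths, because
  the weights of WD-CuSum cost more on longer blocks. Thus \<kappa> is fixed from \<epsilon> first
  and \<open>a\<close> is obtained afterwards.\<close>

lemma lorden_upper_bound:
  fixes d :: "real \<Rightarrow> nat" and T :: "real \<Rightarrow> 'w \<Rightarrow> enat"
  assumes c1: "0 \<le> c1"
    and d: "((\<lambda>\<gamma>. ereal (real (d \<gamma>) * I1 / ln \<gamma>)) \<longlongrightarrow> c1) at_top"
    and st: "\<forall>\<^sub>F \<gamma> in at_top. stop (T \<gamma>)"
    and cross: "\<And>\<kappa>. 0 < \<kappa> \<Longrightarrow> \<exists>a. ((\<lambda>\<gamma>. a \<gamma> / ln \<gamma>) \<longlongrightarrow> 1) at_top \<and>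
      (\<forall>\<^sub>F \<gamma> in at_top. \<forall>v s n \<omega>. 1 \<le> v \<longrightarrow> v \<le> s \<longrightarrow> 1 \<le> n \<longrightarrow> real n \<le> \<kappa> * ln \<gamma> \<longrightarrow>
        \<omega> \<in> block_gt (d \<gamma>) v s n (a \<gamma>) \<longrightarrow> T \<gamma> \<omega> < enat (s + n))"
    and \<epsilon>: "0 < \<epsilon>"
  shows "\<forall>\<^sub>F \<gamma> in at_top. lorden_delay \<mu> X P (d \<gamma>) (T \<gamma>) \<le> ennreal ((1 + \<epsilon>) * (delay_rate c1 * ln \<gamma>))"
proof -
  define K where "K = delay_rate c1"
  define J where "J = min I1 I2"
  define e where "e = \<epsilon> / 3"
  have K: "0 < K" unfolding K_def using c1 by (rule delay_rate_pos)
  have J: "0 < J" using kl_pos by (simp add: J_def)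
  have e: "0 < e" using \<epsilon> by (auto simp: e_def)
  \<comment> \<open>Lengthening the first block by \<open>e * K\<close> gains at least
    \<open>4 * \<delta>\<close> over a drift above \<open>1 - \<delta>\<close>, which suffices for a
    level below \<open>1 + \<delta>\<close> plus a deviation \<delta>. The cap at 1 keeps that
    requirement below the 4 units provided by later blocks.\<close>
  define \<delta> where "\<delta> = min (J * e * K / 4) 1"
  have \<delta>: "0 < \<delta>" "\<delta> \<le> 1" "4 * \<delta> \<le> J * (e * K)" using J e K by (auto simp: \<delta>_def)
  \<comment> \<open>For \<open>q \<le> 1 / 2\<close> the geometric term is at most
    \<open>2 * q\<close>, and \<open>n2\<close> is at most \<open>5 / J * x\<close>; together the
    later blocks add at most \<open>e * K * x\<close>.\<close>
  define q where "q = min (1 / 2) (e * K * J / 10)"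
  have q: "0 < q" "q \<le> 1 / 2" "10 * q \<le> e * K * J" using J e K by (auto simp: q_def)
  define \<kappa> where "\<kappa> = max ((1 + 2 * e) * K) (5 / J)"
  have \<kappa>: "0 < \<kappa>" using J by (simp add: \<kappa>_def less_max_iff_disj)
  obtain a where a: "((\<lambda>\<gamma>. a \<gamma> / ln \<gamma>) \<longlongrightarrow> 1) at_top"
    and cross': "\<forall>\<^sub>F \<gamma> in at_top. \<forall>v s n \<omega>. 1 \<le> v \<longrightarrow> v \<le> s \<longrightarrow> 1 \<le> n \<longrightarrow> real n \<le> \<kappa> * ln \<gamma> \<longrightarrow>
        \<omega> \<in> block_gt (d \<gamma>) v s n (a \<gamma>) \<longrightarrow> T \<gamma> \<omega> < enat (s + n)"
    using cross[OF \<kappa>] by blast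
  obtain R where R: "0 < R" and dev: "\<And>x d v s n. R \<le> x \<Longrightarrow> 1 \<le> v \<Longrightarrow> v \<le> s \<Longrightarrow> real n \<le> \<kappa> * x \<Longrightarrow>
      measure (P d v) {\<omega> \<in> space Pinf. \<delta> * x \<le> \<bar>\<Sum>j\<in>{s..<s+n}. ln (lr d v j (X j \<omega>)) - kl d v j\<bar>} \<le> q"
    using llr_deviation_uniform[of q \<delta> \<kappa>] q \<delta> \<kappa> by auto
  have drift: "\<forall>\<^sub>F \<gamma> in at_top. 1 - \<delta> < I2 * K + (I1 - I2) * min K (real (d \<gamma>) / ln \<gamma>)"
    unfolding K_def using \<delta> by (intro order_tendstoD(1)[OF drift_at_delay_rate[OF c1 d]]) simp
  have a_less: "\<forall>\<^sub>F \<gamma> in at_top. a \<gamma> / ln \<gamma> < 1 + \<delta>"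
    using \<delta> by (intro order_tendstoD(2)[OF a]) simp
  show ?thesis
    using st cross' drift a_less eventually_le_ln[of R] eventually_le_ln[of "1 / (e * K)"]
      eventually_le_ln[of 1] eventually_le_ln[of J]
  proof eventually_elim
    case (elim \<gamma>)
    define x where "x = ln \<gamma>"
    have x: "R \<le> x" "1 \<le> e * K * x" "1 \<le> x" "J \<le> x"
      using elim e K by (auto simp: x_def field_simps)
    have x0: "0 < x" using x(3) by simp
    have Kx0: "0 \<le> K * x" using K x by simp
    have ax: "a \<gamma> + \<delta> * x \<le> (1 + 2 * \<delta>) * x"
      using elim(4) x by (simp add: x_def[symmetric] field_simps)
    define n1 where "n1 = nat \<lceil>(1 + e) * K * x\<rceil>"
    \<comment> \<open>Later blocks may lie anywhere relative to the end of the transient, so only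
      the mean \<open>J\<close> per observation is guaranteed; this length ensures a mean of
      \<open>4 * x\<close>.\<close>
    define n2 where "n2 = nat \<lceil>4 / J * x\<rceil>"
    have pos1: "0 < (1 + e) * K * x" and pos2: "0 < 4 / J * x" using e K x J by auto
    have n1: "(1 + e) * K * x \<le> real n1" "real n1 \<le> (1 + 2 * e) * K * x"
    proof -
      show "(1 + e) * K * x \<le> real n1" unfolding n1_def by (rule real_nat_ceiling_ge)
      have "real n1 < (1 + e) * K * x + 1" unfolding n1_def using pos1 by linarith
      then show "real n1 \<le> (1 + 2 * e) * K * x" using x(2) by (simp add: algebra_simps)
    qed
    have n2: "4 / J * x \<le> real n2" "real n2 \<le> 5 / J * x"
    proof -
      show "4 / J * x \<le> real n2" unfolding n2_def by (rule real_nat_ceiling_ge)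
      have "real n2 < 4 / J * x + 1" unfolding n2_def using pos2 by linarith
      also have "1 \<le> 1 / J * x" using x J by (simp add: field_simps)
      finally show "real n2 \<le> 5 / J * x" by (simp add: field_simps)
    qed
    have n_pos: "1 \<le> n1" "1 \<le> n2" using n1(1) n2(1) pos1 pos2 by (auto simp: Suc_le_eq One_nat_def)
    have n_le: "real n1 \<le> \<kappa> * x" "real n2 \<le> \<kappa> * x"
    proof -
      have "(1 + 2 * e) * K * x \<le> \<kappa> * x" "5 / J * x \<le> \<kappa> * x"
        unfolding \<kappa>_def using x by (intro mult_right_mono; simp)+
      then show "real n1 \<le> \<kappa> * x" "real n2 \<le> \<kappa> * x" using n1 n2 by auto
    qed
    have drift1: "a \<gamma> + \<delta> * x \<le> (\<Sum>j\<in>{v..<v+n1}. kl (d \<gamma>) v j)" for v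
    proof -
      let ?c = "real (d \<gamma>) / x"
      have yK: "(1 + e) * K \<le> real n1 / x"
        using n1 x by (simp add: le_divide_eq)
      have "K \<le> (1 + e) * K" using e K by (simp add: algebra_simps)
      then have yK': "K \<le> real n1 / x" using yK by linarith
      have "J * (real n1 / x - K) \<le> (I2 * (real n1 / x) + (I1 - I2) * min (real n1 / x) ?c) - (I2 * K + (I1 - I2) * min K ?c)"
        unfolding J_def by (rule min_slope[OF yK'])
      moreover have "J * (e * K) \<le> J * (real n1 / x - K)"
        using yK J by (intro mult_left_mono) (auto simp: algebra_simps)
      ultimately have "1 + 2 * \<delta> \<le> I2 * (real n1 / x) + (I1 - I2) * min (real n1 / x) ?c"
        using elim(3) \<delta> unfolding x_def by linarith
      then have "x * (1 + 2 * \<delta>) \<le> x * (I2 * (real n1 / x) + (I1 - I2) * min (real n1 / x) ?c)"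
        using x by (intro mult_left_mono) auto
      then show ?thesis
        unfolding sum_kl_onset min_scale[OF x0] using ax by (simp add: algebra_simps)
    qed
    have drift2: "a \<gamma> + \<delta> * x \<le> (\<Sum>j\<in>{s..<s+n2}. kl (d \<gamma>) v j)" for v s
    proof -
      have "(1 + 2 * \<delta>) * x \<le> 4 * x" using \<delta> x by (intro mult_right_mono) auto
      also have "\<dots> = J * (4 / J * x)" using J by simp
      also have "\<dots> \<le> J * real n2" using n2 J by (intro mult_left_mono) auto
      also have "\<dots> \<le> (\<Sum>j\<in>{s..<s+n2}. kl (d \<gamma>) v j)"
        unfolding J_def by (rule sum_kl_ge)
      finally show ?thesis using ax by simp
    qed
    have "lorden_delay \<mu> X P (d \<gamma>) (T \<gamma>) \<le> ennreal (n1 + n2 * (q / (1 - q)))"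
    proof (rule lorden_delay_le[where a="a \<gamma>"])
      show "T \<gamma> \<omega> < enat (s + n)" if "1 \<le> v" "v \<le> s" "n \<in> {n1, n2}" "\<omega> \<in> block_gt (d \<gamma>) v s n (a \<gamma>)" for v s n \<omega>
        using elim(2) that n_pos n_le unfolding x_def by blast
      show "1 - q \<le> measure (P (d \<gamma>) v) (block_gt (d \<gamma>) v v n1 (a \<gamma>))" if "1 \<le> v" for v
        using that by (intro measure_block_gt_ge[OF _ _ drift1] dev x n_le) auto
      show "1 - q \<le> measure (P (d \<gamma>) v) (block_gt (d \<gamma>) v s n2 (a \<gamma>))" if "1 \<le> v" "v \<le> s" for v s
        using that by (intro measure_block_gt_ge[OF _ _ drift2] dev x n_le) auto
    qed (use elim(1) q n_pos in auto)
    also have "\<dots> \<le> ennreal ((1 + \<epsilon>) * (K * x))"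
    proof (rule ennreal_leI)
      have "q / (1 - q) \<le> 2 * q" using q by (simp add: field_simps)
      then have "n2 * (q / (1 - q)) \<le> 5 / J * x * (2 * q)"
        using n2 q J x by (intro mult_mono) auto
      also have "\<dots> = (10 * q) * x / J" by simp
      also have "\<dots> \<le> (e * K * J) * x / J"
        using q x J by (intro divide_right_mono mult_right_mono) auto
      also have "\<dots> = e * K * x" using J by simp
      finally have "n1 + n2 * (q / (1 - q)) \<le> (1 + 2 * e) * K * x + e * K * x"
        using n1 by linarith
      also have "\<dots> = (1 + \<epsilon>) * (K * x)" by (simp add: e_def algebra_simps)
      finally show "n1 + n2 * (q / (1 - q)) \<le> (1 + \<epsilon>) * (K * x)" .
    qed
    finally show ?case by (simp add: K_def x_def)
  qed
qed

section \<open>Asymptotic optimality of both rules\<close>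

text \<open>The infimum of Pollak's delay is the smallest of the four delays and Lorden's delay of
  \<open>T\<close> the largest. The lower bound on the former and the upper bound on the latter
  confine all four to within a factor \<open>1 - \<epsilon>\<close> to \<open>1 + \<epsilon>\<close>
  of the same function.\<close>

lemma asymptotic_optimality:
  fixes d :: "real \<Rightarrow> nat" and T :: "real \<Rightarrow> 'w \<Rightarrow> enat"
  assumes c1: "0 \<le> c1"
    and d: "((\<lambda>\<gamma>. ereal (real (d \<gamma>) * I1 / ln \<gamma>)) \<longlongrightarrow> c1) at_top"
    and T: "\<forall>\<^sub>F \<gamma> in at_top. T \<gamma> \<in> C_class \<mu> X Pinf \<gamma>"
    and cross: "\<And>\<kappa>. 0 < \<kappa> \<Longrightarrow> \<exists>a. ((\<lambda>\<gamma>. a \<gamma> / ln \<gamma>) \<longlongrightarrow> 1) at_top \<and>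
      (\<forall>\<^sub>F \<gamma> in at_top. \<forall>v s n \<omega>. 1 \<le> v \<longrightarrow> v \<le> s \<longrightarrow> 1 \<le> n \<longrightarrow> real n \<le> \<kappa> * ln \<gamma> \<longrightarrow>
        \<omega> \<in> block_gt (d \<gamma>) v s n (a \<gamma>) \<longrightarrow> T \<gamma> \<omega> < enat (s + n))"
  shows "ratio_equiv (\<lambda>\<gamma>. lorden_delay \<mu> X P (d \<gamma>) (T \<gamma>))
          (\<lambda>\<gamma>. INF \<tau> \<in> C_class \<mu> X Pinf \<gamma>. lorden_delay \<mu> X P (d \<gamma>) \<tau>) \<and>
        ratio_equiv (\<lambda>\<gamma>. INF \<tau> \<in> C_class \<mu> X Pinf \<gamma>. lorden_delay \<mu> X P (d \<gamma>) \<tau>)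
          (\<lambda>\<gamma>. pollak_delay P (d \<gamma>) (T \<gamma>)) \<and>
        ratio_equiv (\<lambda>\<gamma>. pollak_delay P (d \<gamma>) (T \<gamma>))
          (\<lambda>\<gamma>. INF \<tau> \<in> C_class \<mu> X Pinf \<gamma>. pollak_delay P (d \<gamma>) \<tau>) \<and>
        ratio_equiv (\<lambda>\<gamma>. INF \<tau> \<in> C_class \<mu> X Pinf \<gamma>. pollak_delay P (d \<gamma>) \<tau>)
          (\<lambda>\<gamma>. ennreal (opt_delay I1 I2 c1 \<gamma>))"
proof -
  define D where "D \<gamma> = delay_rate c1 * ln \<gamma>" for \<gamma>
  have D: "\<forall>\<^sub>F \<gamma> in at_top. 0 < D \<gamma>"
    using eventually_le_ln[of 1] by eventually_elim (use delay_rate_pos[OF c1] in \<open>auto simp: D_def\<close>)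
  have st: "\<forall>\<^sub>F \<gamma> in at_top. stop (T \<gamma>)"
    using T by eventually_elim (rule C_classD)
  define JL JP IL IP where "JL \<gamma> = lorden_delay \<mu> X P (d \<gamma>) (T \<gamma>)" and "JP \<gamma> = pollak_delay P (d \<gamma>) (T \<gamma>)"
    and "IL \<gamma> = (INF \<tau> \<in> C_class \<mu> X Pinf \<gamma>. lorden_delay \<mu> X P (d \<gamma>) \<tau>)"
    and "IP \<gamma> = (INF \<tau> \<in> C_class \<mu> X Pinf \<gamma>. pollak_delay P (d \<gamma>) \<tau>)" for \<gamma>
  have upper_bound: "\<forall>\<^sub>F \<gamma> in at_top. lorden_delay \<mu> X P (d \<gamma>) (T \<gamma>) \<le> ennreal ((1 + \<epsilon>) * (delay_rate c1 * ln \<gamma>))"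
    if "0 < \<epsilon>" for \<epsilon>
    by (rule lorden_upper_bound[OF c1 d st _ that]) (rule cross)
  have all: "\<forall>\<^sub>F \<gamma> in at_top. \<forall>g\<in>{JL \<gamma>, JP \<gamma>, IL \<gamma>, IP \<gamma>, ennreal (D \<gamma>)}.
      ennreal ((1 - \<epsilon>) * D \<gamma>) \<le> g \<and> g \<le> ennreal ((1 + \<epsilon>) * D \<gamma>)" if \<epsilon>: "0 < \<epsilon>" "\<epsilon> < 1" for \<epsilon>
    using D T st pollak_lower_bound[OF c1 d \<epsilon>] upper_bound[OF \<epsilon>(1)]
  proof eventually_elim
    case (elim \<gamma>)
    have lower: "ennreal ((1 - \<epsilon>) * D \<gamma>) \<le> IP \<gamma>"
      unfolding IP_def D_def using elim(4) by (intro INF_greatest) auto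
    have IPIL: "IP \<gamma> \<le> IL \<gamma>"
      unfolding IP_def IL_def by (intro INF_mono) (auto intro: pollak_le_lorden dest: C_classD)
    have IPJP: "IP \<gamma> \<le> JP \<gamma>"
      unfolding IP_def JP_def using elim(2) by (rule INF_lower)
    have ILJL: "IL \<gamma> \<le> JL \<gamma>"
      unfolding IL_def JL_def using elim(2) by (rule INF_lower)
    have JPJL: "JP \<gamma> \<le> JL \<gamma>"
      unfolding JP_def JL_def using elim(3) by (rule pollak_le_lorden)
    have upper: "JL \<gamma> \<le> ennreal ((1 + \<epsilon>) * D \<gamma>)"
      unfolding JL_def D_def using elim(5) .
    have "ennreal ((1 - \<epsilon>) * D \<gamma>) \<le> ennreal (D \<gamma>)" "ennreal (D \<gamma>) \<le> ennreal ((1 + \<epsilon>) * D \<gamma>)"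
      using elim(1) \<epsilon> by (auto intro!: ennreal_leI simp: algebra_simps)
    then show ?case
      using lower IPIL IPJP ILJL JPJL upper by (auto intro: order.trans)
  qed
  have sandwich: "\<forall>\<^sub>F \<gamma> in at_top. ennreal ((1 - \<epsilon>) * D \<gamma>) \<le> g \<gamma> \<and> g \<gamma> \<le> ennreal ((1 + \<epsilon>) * D \<gamma>)"
    if "0 < \<epsilon>" "\<epsilon> < 1" "g \<in> {JL, JP, IL, IP, \<lambda>\<gamma>. ennreal (D \<gamma>)}" for g \<epsilon>
    using all[OF that(1,2)] by eventually_elim (use that(3) in auto)
  have equiv: "ratio_equiv g h"
    if "g \<in> {JL, JP, IL, IP, \<lambda>\<gamma>. ennreal (D \<gamma>)}" "h \<in> {JL, JP, IL, IP, \<lambda>\<gamma>. ennreal (D \<gamma>)}" for g h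
    by (rule ratio_equiv_sandwich[OF D]) (use sandwich that in auto)
  have "ratio_equiv JL IL \<and> ratio_equiv IL JP \<and> ratio_equiv JP IP \<and> ratio_equiv IP (\<lambda>\<gamma>. ennreal (D \<gamma>))"
    by (intro conjI equiv) auto
  then show ?thesis
    unfolding JL_def[abs_def] JP_def[abs_def] IL_def[abs_def] IP_def[abs_def] opt_delay_eq D_def[abs_def] .
qed

lemma dcusum_crosses:
  fixes d :: "real \<Rightarrow> nat" and b :: "real \<Rightarrow> real"
  assumes "((\<lambda>\<gamma>. b \<gamma> / ln \<gamma>) \<longlongrightarrow> 1) at_top"
  shows "\<exists>a. ((\<lambda>\<gamma>. a \<gamma> / ln \<gamma>) \<longlongrightarrow> 1) at_top \<and>
      (\<forall>\<^sub>F \<gamma> in at_top. \<forall>v s n \<omega>. 1 \<le> v \<longrightarrow> v \<le> s \<longrightarrow> 1 \<le> n \<longrightarrow> real n \<le> \<kappa> * ln \<gamma> \<longrightarrow>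
        \<omega> \<in> block_gt (d \<gamma>) v s n (a \<gamma>) \<longrightarrow> dcusum f0 f1 f2 X (b \<gamma>) \<omega> < enat (s + n))"
  using assms dcusum_less by (intro exI[of _ b] conjI always_eventually) auto

text \<open>The level is that of \<open>wdcusum_less\<close> with \<open>n\<close> replaced by its
  maximum \<open>\<kappa> * ln \<gamma>\<close>. It stays equivalent to \<open>ln \<gamma>\<close>
  because \<open>ln \<rho>\<close> is negligible against \<open>b\<close> and
  \<open>ln (1 - \<rho>)\<close> tends to 0.\<close>

lemma wdcusum_crosses:
  fixes d :: "real \<Rightarrow> nat" and b \<rho> :: "real \<Rightarrow> real"
  assumes b: "((\<lambda>\<gamma>. b \<gamma> / ln \<gamma>) \<longlongrightarrow> 1) at_top"
    and ev: "\<forall>\<^sub>F \<gamma> in at_top. 0 < b \<gamma> \<and> 0 < \<rho> \<gamma> \<and> \<rho> \<gamma> < 1"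
    and \<rho>: "(\<rho> \<longlongrightarrow> 0) at_top" and ln\<rho>: "((\<lambda>\<gamma>. ln (\<rho> \<gamma>) / b \<gamma>) \<longlongrightarrow> 0) at_top"
  shows "\<exists>a. ((\<lambda>\<gamma>. a \<gamma> / ln \<gamma>) \<longlongrightarrow> 1) at_top \<and>
      (\<forall>\<^sub>F \<gamma> in at_top. \<forall>v s n \<omega>. 1 \<le> v \<longrightarrow> v \<le> s \<longrightarrow> 1 \<le> n \<longrightarrow> real n \<le> \<kappa> * ln \<gamma> \<longrightarrow>
        \<omega> \<in> block_gt (d \<gamma>) v s n (a \<gamma>) \<longrightarrow> wdcusum f0 f1 f2 X (\<rho> \<gamma>) (b \<gamma>) \<omega> < enat (s + n))"
proof (intro exI[of _ "\<lambda>\<gamma>. b \<gamma> - ln (\<rho> \<gamma>) - \<kappa> * ln \<gamma> * ln (1 - \<rho> \<gamma>)"] conjI)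
  \<comment> \<open>The assumption compares \<open>ln \<rho>\<close> with \<open>b\<close>, so its
    ratio to \<open>ln \<gamma>\<close> is written as a product with \<open>b / ln \<gamma>\<close>,
    which tends to 1.\<close>
  have "((\<lambda>\<gamma>. b \<gamma> / ln \<gamma> - ln (\<rho> \<gamma>) / b \<gamma> * (b \<gamma> / ln \<gamma>) - \<kappa> * ln (1 - \<rho> \<gamma>)) \<longlongrightarrow> 1 - 0 * 1 - \<kappa> * ln (1 - 0)) at_top"
    by (intro tendsto_intros b \<rho> ln\<rho>) auto
  moreover have "\<forall>\<^sub>F \<gamma> in at_top. b \<gamma> / ln \<gamma> - ln (\<rho> \<gamma>) / b \<gamma> * (b \<gamma> / ln \<gamma>) - \<kappa> * ln (1 - \<rho> \<gamma>) =
      (b \<gamma> - ln (\<rho> \<gamma>) - \<kappa> * ln \<gamma> * ln (1 - \<rho> \<gamma>)) / ln \<gamma>"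
    using ev eventually_le_ln[of 1] by eventually_elim (simp add: field_simps)
  ultimately show "((\<lambda>\<gamma>. (b \<gamma> - ln (\<rho> \<gamma>) - \<kappa> * ln \<gamma> * ln (1 - \<rho> \<gamma>)) / ln \<gamma>) \<longlongrightarrow> 1) at_top"
    by (simp add: filterlim_cong[OF refl refl])
  show "\<forall>\<^sub>F \<gamma> in at_top. \<forall>v s n \<omega>. 1 \<le> v \<longrightarrow> v \<le> s \<longrightarrow> 1 \<le> n \<longrightarrow> real n \<le> \<kappa> * ln \<gamma> \<longrightarrow>
        \<omega> \<in> block_gt (d \<gamma>) v s n (b \<gamma> - ln (\<rho> \<gamma>) - \<kappa> * ln \<gamma> * ln (1 - \<rho> \<gamma>)) \<longrightarrow>
        wdcusum f0 f1 f2 X (\<rho> \<gamma>) (b \<gamma>) \<omega> < enat (s + n)"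
    using ev
  proof eventually_elim
    case (elim \<gamma>)
    show ?case
    proof (intro allI impI)
      fix v s n :: nat and \<omega>
      assume v: "1 \<le> v" "v \<le> s" "1 \<le> n" and n: "real n \<le> \<kappa> * ln \<gamma>"
        and \<omega>: "\<omega> \<in> block_gt (d \<gamma>) v s n (b \<gamma> - ln (\<rho> \<gamma>) - \<kappa> * ln \<gamma> * ln (1 - \<rho> \<gamma>))"
      have "(\<kappa> * ln \<gamma>) * ln (1 - \<rho> \<gamma>) \<le> real n * ln (1 - \<rho> \<gamma>)"
        using elim n by (intro mult_right_mono_neg) auto
      then show "wdcusum f0 f1 f2 X (\<rho> \<gamma>) (b \<gamma>) \<omega> < enat (s + n)"
        using elim v by (intro wdcusum_less[OF _ _ _ _ _ \<omega>]) auto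
    qed
  qed
qed

end

theorem theorem4:
  fixes \<mu> :: "'s measure"
    and f0 f1 f2 :: "'s \<Rightarrow> real"
    and X :: "nat \<Rightarrow> 'w \<Rightarrow> 's"
    and Pinf :: "'w measure"
    and P :: "nat \<Rightarrow> nat \<Rightarrow> 'w measure"
    and d :: "real \<Rightarrow> nat"
    and c1 :: ereal
  assumes model: "transient_change_model \<mu> f0 f1 f2 X Pinf P"
    and d_lim: "filterlim d at_top at_top"
    and c1_nonneg: "0 \<le> c1"
    and d_asymp: "((\<lambda>\<gamma>. ereal (real (d \<gamma>) * kl_number \<mu> f1 f0 / ln \<gamma>)) \<longlongrightarrow> c1) at_top"
  shows
    "(\<forall>b :: real \<Rightarrow> real.
        (\<forall>\<^sub>F \<gamma> in at_top. 0 < b \<gamma> \<and> dcusum f0 f1 f2 X (b \<gamma>) \<in> C_class \<mu> X Pinf \<gamma>) \<and>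
        ((\<lambda>\<gamma>. b \<gamma> / ln \<gamma>) \<longlongrightarrow> 1) at_top \<longrightarrow>
        ratio_equiv
          (\<lambda>\<gamma>. lorden_delay \<mu> X P (d \<gamma>) (dcusum f0 f1 f2 X (b \<gamma>)))
          (\<lambda>\<gamma>. INF \<tau> \<in> C_class \<mu> X Pinf \<gamma>. lorden_delay \<mu> X P (d \<gamma>) \<tau>) \<and>
        ratio_equiv
          (\<lambda>\<gamma>. INF \<tau> \<in> C_class \<mu> X Pinf \<gamma>. lorden_delay \<mu> X P (d \<gamma>) \<tau>)
          (\<lambda>\<gamma>. pollak_delay P (d \<gamma>) (dcusum f0 f1 f2 X (b \<gamma>))) \<and>
        ratio_equiv
          (\<lambda>\<gamma>. pollak_delay P (d \<gamma>) (dcusum f0 f1 f2 X (b \<gamma>)))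
          (\<lambda>\<gamma>. INF \<tau> \<in> C_class \<mu> X Pinf \<gamma>. pollak_delay P (d \<gamma>) \<tau>) \<and>
        ratio_equiv
          (\<lambda>\<gamma>. INF \<tau> \<in> C_class \<mu> X Pinf \<gamma>. pollak_delay P (d \<gamma>) \<tau>)
          (\<lambda>\<gamma>. ennreal (opt_delay (kl_number \<mu> f1 f0) (kl_number \<mu> f2 f0) c1 \<gamma>))) \<and>
     (\<forall>(b :: real \<Rightarrow> real) (\<rho> :: real \<Rightarrow> real).
        (\<forall>\<^sub>F \<gamma> in at_top. 0 < b \<gamma> \<and> 0 < \<rho> \<gamma> \<and> \<rho> \<gamma> < 1 \<and>
          ennreal \<gamma> \<le> (\<integral>\<^sup>+\<omega>. ennreal_of_enat (wdcusum f0 f1 f2 X (\<rho> \<gamma>) (b \<gamma>) \<omega>) \<partial>Pinf)) \<and>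
        ((\<lambda>\<gamma>. b \<gamma> / ln \<gamma>) \<longlongrightarrow> 1) at_top \<and>
        (\<rho> \<longlongrightarrow> 0) at_top \<and>
        ((\<lambda>\<gamma>. ln (\<rho> \<gamma>) / b \<gamma>) \<longlongrightarrow> 0) at_top \<longrightarrow>
        ratio_equiv
          (\<lambda>\<gamma>. lorden_delay \<mu> X P (d \<gamma>) (wdcusum f0 f1 f2 X (\<rho> \<gamma>) (b \<gamma>)))
          (\<lambda>\<gamma>. INF \<tau> \<in> C_class \<mu> X Pinf \<gamma>. lorden_delay \<mu> X P (d \<gamma>) \<tau>) \<and>
        ratio_equiv
          (\<lambda>\<gamma>. INF \<tau> \<in> C_class \<mu> X Pinf \<gamma>. lorden_delay \<mu> X P (d \<gamma>) \<tau>)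
          (\<lambda>\<gamma>. pollak_delay P (d \<gamma>) (wdcusum f0 f1 f2 X (\<rho> \<gamma>) (b \<gamma>))) \<and>
        ratio_equiv
          (\<lambda>\<gamma>. pollak_delay P (d \<gamma>) (wdcusum f0 f1 f2 X (\<rho> \<gamma>) (b \<gamma>)))
          (\<lambda>\<gamma>. INF \<tau> \<in> C_class \<mu> X Pinf \<gamma>. pollak_delay P (d \<gamma>) \<tau>) \<and>
        ratio_equiv
          (\<lambda>\<gamma>. INF \<tau> \<in> C_class \<mu> X Pinf \<gamma>. pollak_delay P (d \<gamma>) \<tau>)
          (\<lambda>\<gamma>. ennreal (opt_delay (kl_number \<mu> f1 f0) (kl_number \<mu> f2 f0) c1 \<gamma>)))"
proof -
  interpret transient_change_model \<mu> f0 f1 f2 X Pinf P by (rule model)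
  note optimal = asymptotic_optimality[OF c1_nonneg d_asymp]
  show ?thesis
  proof (intro conjI[of "All _" "All _"] allI impI; elim conjE)
    fix b :: "real \<Rightarrow> real"
    assume C: "\<forall>\<^sub>F \<gamma> in at_top. 0 < b \<gamma> \<and> dcusum f0 f1 f2 X (b \<gamma>) \<in> C_class \<mu> X Pinf \<gamma>"
      and b: "((\<lambda>\<gamma>. b \<gamma> / ln \<gamma>) \<longlongrightarrow> 1) at_top"
    show "ratio_equiv
          (\<lambda>\<gamma>. lorden_delay \<mu> X P (d \<gamma>) (dcusum f0 f1 f2 X (b \<gamma>)))
          (\<lambda>\<gamma>. INF \<tau> \<in> C_class \<mu> X Pinf \<gamma>. lorden_delay \<mu> X P (d \<gamma>) \<tau>) \<and>
        ratio_equiv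
          (\<lambda>\<gamma>. INF \<tau> \<in> C_class \<mu> X Pinf \<gamma>. lorden_delay \<mu> X P (d \<gamma>) \<tau>)
          (\<lambda>\<gamma>. pollak_delay P (d \<gamma>) (dcusum f0 f1 f2 X (b \<gamma>))) \<and>
        ratio_equiv
          (\<lambda>\<gamma>. pollak_delay P (d \<gamma>) (dcusum f0 f1 f2 X (b \<gamma>)))
          (\<lambda>\<gamma>. INF \<tau> \<in> C_class \<mu> X Pinf \<gamma>. pollak_delay P (d \<gamma>) \<tau>) \<and>
        ratio_equiv
          (\<lambda>\<gamma>. INF \<tau> \<in> C_class \<mu> X Pinf \<gamma>. pollak_delay P (d \<gamma>) \<tau>)
          (\<lambda>\<gamma>. ennreal (opt_delay (kl_number \<mu> f1 f0) (kl_number \<mu> f2 f0) c1 \<gamma>))"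
      by (rule optimal) (use C dcusum_crosses[OF b] in \<open>auto elim: eventually_mono\<close>)
  next
    fix b \<rho> :: "real \<Rightarrow> real"
    assume ev: "\<forall>\<^sub>F \<gamma> in at_top. 0 < b \<gamma> \<and> 0 < \<rho> \<gamma> \<and> \<rho> \<gamma> < 1 \<and>
          ennreal \<gamma> \<le> (\<integral>\<^sup>+\<omega>. ennreal_of_enat (wdcusum f0 f1 f2 X (\<rho> \<gamma>) (b \<gamma>) \<omega>) \<partial>Pinf)"
      and lims: "((\<lambda>\<gamma>. b \<gamma> / ln \<gamma>) \<longlongrightarrow> 1) at_top" "(\<rho> \<longlongrightarrow> 0) at_top"
        "((\<lambda>\<gamma>. ln (\<rho> \<gamma>) / b \<gamma>) \<longlongrightarrow> 0) at_top"
    have C: "\<forall>\<^sub>F \<gamma> in at_top. wdcusum f0 f1 f2 X (\<rho> \<gamma>) (b \<gamma>) \<in> C_class \<mu> X Pinf \<gamma>"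
      using ev by eventually_elim (simp add: C_class_def stop_wdcusum)
    have ev': "\<forall>\<^sub>F \<gamma> in at_top. 0 < b \<gamma> \<and> 0 < \<rho> \<gamma> \<and> \<rho> \<gamma> < 1"
      using ev by eventually_elim simp
    show "ratio_equiv
          (\<lambda>\<gamma>. lorden_delay \<mu> X P (d \<gamma>) (wdcusum f0 f1 f2 X (\<rho> \<gamma>) (b \<gamma>)))
          (\<lambda>\<gamma>. INF \<tau> \<in> C_class \<mu> X Pinf \<gamma>. lorden_delay \<mu> X P (d \<gamma>) \<tau>) \<and>
        ratio_equiv
          (\<lambda>\<gamma>. INF \<tau> \<in> C_class \<mu> X Pinf \<gamma>. lorden_delay \<mu> X P (d \<gamma>) \<tau>)
          (\<lambda>\<gamma>. pollak_delay P (d \<gamma>) (wdcusum f0 f1 f2 X (\<rho> \<gamma>) (b \<gamma>))) \<and>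
        ratio_equiv
          (\<lambda>\<gamma>. pollak_delay P (d \<gamma>) (wdcusum f0 f1 f2 X (\<rho> \<gamma>) (b \<gamma>)))
          (\<lambda>\<gamma>. INF \<tau> \<in> C_class \<mu> X Pinf \<gamma>. pollak_delay P (d \<gamma>) \<tau>) \<and>
        ratio_equiv
          (\<lambda>\<gamma>. INF \<tau> \<in> C_class \<mu> X Pinf \<gamma>. pollak_delay P (d \<gamma>) \<tau>)
          (\<lambda>\<gamma>. ennreal (opt_delay (kl_number \<mu> f1 f0) (kl_number \<mu> f2 f0) c1 \<gamma>))"
      by (rule optimal[OF C wdcusum_crosses[OF lims(1) ev' lims(2,3)]])
  qed
qed

end
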